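(* Let $\mathcal{H}$ be a unitarily invariant space of pluriharmonic functions on $\mathbb{B}_d$ whose reproducing kernel $K$ has non-negative real part. Let $F \subset \partial\mathbb{B}_d$ be a compact set. Then $$\operatorname{cap}_{\mathcal{H}}(F) = \inf\{\|f\|_{\mathcal{H}}^2 : f \in \mathcal{H} \cap C(\overline{\mathbb{B}_d}),\ \operatorname{Re} f \ge 1 \text{ on } F\}.$$
   Context: $\mathbb{B}_d$ is the open Euclidean unit ball of $\mathbb{C}^d$ ($d \ge 1$), with boundary sphere $\partial\mathbb{B}_d$. A unitarily invariant space of pluriharmonic functions on $\mathbb{B}_d$ is a reproducing kernel Hilbert space $\mathcal{H}$ of functions on $\mathbb{B}_d$ whose reproducing kernel has the form $$K(z,w) = \sum_{n=0}^\infty a_n \langle z,w\rangle^n + \sum_{n=1}^\infty a_{-n}\overline{\langle z,w\rangle}^n,$$ where $a_n \ge 0$ for all $n \in \mathbb{Z}$, $a_0 = 1$, and the series converges on $\mathbb{B}_d \times \mathbb{B}_d$. $\mathcal{H} \cap C(\overline{\mathbb{B}_d})$ denotes the functions in $\mathcal{H}$ that extend continuously to $\overline{\mathbb{B}_d}$ (identified with their extensions). The $\mathcal{H}$-energy of a Borel probability measure $\mu$ on $\partial\mathbb{B}_d$ is $\mathcal{E}(\mu) = \sup_{0 \le r < 1} \int\int K(rz,rw)\, d\mu(w)\, d\mu(z) \in [0,\infty]$ (the double integrals are non-negative reals, increasing in $r$). For compact $F \subset \partial\mathbb{B}_d$, $\operatorname{cap}_{\mathcal{H}}(F) = \sup\{1/\mathcal{E}(\mu)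 : \mu$ a Borel probability measure supported on $F\}$ (with $1/\infty = 0$ and $\operatorname{cap}(\emptyset) = 0$). *)

theory Defs
  imports "HOL-Probability.Probability"
begin

definition herm :: "complex ^ 'n \<Rightarrow> complex ^ 'n \<Rightarrow> complex" where
  "herm z w = (\<Sum>i\<in>UNIV. z $ i * cnj (w $ i))"

definition ip_norm :: "('b \<Rightarrow> 'b \<Rightarrow> complex) \<Rightarrow> 'b \<Rightarrow> real" where
  "ip_norm ip f = sqrt (Re (ip f f))"

text \<open>
  A complex-valued function on the set \<open>X\<close> is represented by the total function that takes
  the value \<open>0\<close> outside \<open>X\<close>, so that equality of representatives is equality on \<open>X\<close>.
  The inner product is linear in its first argument.
\<close>

locale hilbert_function_space =
  fixes X :: "'a set"
    and H :: "('a \<Rightarrow> complex) set"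
    and ip :: "('a \<Rightarrow> complex) \<Rightarrow> ('a \<Rightarrow> complex) \<Rightarrow> complex"
  assumes vanishes_outside: "\<And>f x. f \<in> H \<Longrightarrow> x \<notin> X \<Longrightarrow> f x = 0"
    and zero_mem: "(\<lambda>x. 0) \<in> H"
    and add_mem: "\<And>f g. f \<in> H \<Longrightarrow> g \<in> H \<Longrightarrow> (\<lambda>x. f x + g x) \<in> H"
    and scale_mem: "\<And>c f. f \<in> H \<Longrightarrow> (\<lambda>x. c * f x) \<in> H"
    and ip_add_left:
      "\<And>f g h. f \<in> H \<Longrightarrow> g \<in> H \<Longrightarrow> h \<in> H \<Longrightarrow> ip (\<lambda>x. f x + g x) h = ip f h + ip g h"
    and ip_scale_left:
      "\<And>c f h. f \<in> H \<Longrightarrow> h \<in> H \<Longrightarrow> ip (\<lambda>x. c * f x) h = c * ip f h"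
    and ip_commute: "\<And>f g. f \<in> H \<Longrightarrow> g \<in> H \<Longrightarrow> ip g f = cnj (ip f g)"
    and ip_nonneg: "\<And>f. f \<in> H \<Longrightarrow> 0 \<le> Re (ip f f)"
    and ip_definite: "\<And>f. f \<in> H \<Longrightarrow> ip f f = 0 \<Longrightarrow> f = (\<lambda>x. 0)"
    and complete:
      "\<And>u :: nat \<Rightarrow> 'a \<Rightarrow> complex. (\<And>n. u n \<in> H) \<Longrightarrow>
         (\<And>e. e > 0 \<Longrightarrow> \<exists>N. \<forall>m\<ge>N. \<forall>n\<ge>N. ip_norm ip (\<lambda>x. u m x - u n x) < e) \<Longrightarrow>
         \<exists>g\<in>H. (\<lambda>n. ip_norm ip (\<lambda>x. u n x - g x)) \<longlonglongrightarrow> 0"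

text \<open>
  \<open>K\<close> is only used on \<open>X \<times> X\<close>; its values elsewhere are irrelevant.
\<close>

locale rkhs = hilbert_function_space X H ip
  for X :: "'a set" and H :: "('a \<Rightarrow> complex) set"
    and ip :: "('a \<Rightarrow> complex) \<Rightarrow> ('a \<Rightarrow> complex) \<Rightarrow> complex" +
  fixes K :: "'a \<Rightarrow> 'a \<Rightarrow> complex"
  assumes kernel_mem: "\<And>w. w \<in> X \<Longrightarrow> (\<lambda>z. if z \<in> X then K z w else 0) \<in> H"
    and reproducing:
      "\<And>f w. f \<in> H \<Longrightarrow> w \<in> X \<Longrightarrow> ip f (\<lambda>z. if z \<in> X then K z w else 0) = f w"

locale unitarily_invariant_pluriharmonic_space =
  rkhs "ball 0 1 :: (complex ^ 'n) set" H ip K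
  for H :: "(complex ^ 'n \<Rightarrow> complex) set" and ip K +
  assumes kernel_expansion:
    "\<exists>a :: int \<Rightarrow> real. (\<forall>n. a n \<ge> 0) \<and> a 0 = 1 \<and>
       (\<forall>z\<in>ball 0 1. \<forall>w\<in>ball 0 1.
          summable (\<lambda>n. of_real (a (int n)) * herm z w ^ n) \<and>
          summable (\<lambda>n. of_real (a (- int (Suc n))) * cnj (herm z w) ^ Suc n) \<and>
          K z w = (\<Sum>n. of_real (a (int n)) * herm z w ^ n)
                + (\<Sum>n. of_real (a (- int (Suc n))) * cnj (herm z w) ^ Suc n))"

text \<open>
  For the kernels considered here the double integral is a non-negative real number, so
  neither \<^const>\<open>Re\<close> nor \<^const>\<open>ennreal\<close> loses information.
\<close>

definition energy ::
  "(complex ^ 'n \<Rightarrow> complex ^ 'n \<Rightarrow> complex) \<Rightarrow> (complex ^ 'n) measure \<Rightarrow> ennreal" where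
  "energy K \<mu> =
     (SUP r\<in>{0..<1::real}. ennreal (Re (\<integral>z. (\<integral>w. K (r *\<^sub>R z) (r *\<^sub>R w) \<partial>\<mu>) \<partial>\<mu>)))"

text \<open>
  For closed \<open>F\<close>, the support of \<open>\<mu>\<close> is contained in \<open>F\<close> iff the complement of \<open>F\<close> is a null set.
\<close>

definition prob_measures_on :: "(complex ^ 'n) set \<Rightarrow> (complex ^ 'n) measure set" where
  "prob_measures_on F =
     {\<mu>. prob_space \<mu> \<and> sets \<mu> = sets (restrict_space borel (sphere 0 1)) \<and>
         emeasure \<mu> (sphere 0 1 - F) = 0}"

text \<open>
  In \<^typ>\<open>ennreal\<close> one has \<open>1 / \<infinity> = 0\<close>, and the supremum of the empty set is \<open>0\<close>.
\<close>

definition capacity ::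
  "(complex ^ 'n \<Rightarrow> complex ^ 'n \<Rightarrow> complex) \<Rightarrow> (complex ^ 'n) set \<Rightarrow> ennreal" where
  "capacity K F = (SUP \<mu>\<in>prob_measures_on F. 1 / energy K \<mu>)"

definition continuous_extension ::
  "(complex ^ 'n \<Rightarrow> complex) \<Rightarrow> (complex ^ 'n \<Rightarrow> complex) \<Rightarrow> bool" where
  "continuous_extension f g \<longleftrightarrow>
     continuous_on (cball 0 1) g \<and> (\<forall>z\<in>ball 0 1. g z = f z)"

end

theory Submission
  imports Defs
begin

text \<open>
  If \<open>\<mu>\<close> is a probability measure on \<open>F\<close> and \<open>f\<close> is admissible, then
  \<open>\<bar>\<integral> f(rz) d\<mu>\<bar>\<^sup>2 \<le> \<parallel>f\<parallel>\<^sup>2 \<integral>\<integral> K(rz, rw) d\<mu> d\<mu>\<close> by Cauchy-Schwarz, and \<open>r \<rightarrow> 1\<close> gives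
  \<open>1 \<le> \<parallel>f\<parallel>\<^sup>2 E(\<mu>)\<close>. Conversely, for fixed \<open>r < 1\<close> let \<open>p\<close> nearly minimise the \<open>r\<close>-energy among the
  finitely supported probability measures on \<open>F\<close>, with infimum \<open>c\<close>. By the variational
  inequality the potential \<open>z \<mapsto> \<Sum>\<^sub>x p(x) K(rz, rx)\<close> has real part at least about \<open>c\<close> on \<open>F\<close>. It
  belongs to \<open>H\<close> because \<open>K(rz, rx) = K(z, r\<^sup>2x)\<close>, it is continuous on the closed ball, and its
  squared norm is the \<open>r\<^sup>2\<close>-energy of \<open>p\<close>, hence at most about \<open>c\<close>. Dividing by \<open>c\<close> shows that
  the infimum \<open>I\<close> of the squared norms is at most \<open>1/c\<close>. So for every \<open>r\<close> there are discrete
  measures with \<open>r\<close>-energy close to \<open>1/I\<close>, and a weak limit of these as \<open>r \<rightarrow> 1\<close> has energy at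
  most \<open>1/I\<close>.
\<close>

section \<open>Weak compactness by lifting to the real line\<close>

text \<open>
  Schoenberg's space-filling curve: modulo 2, \<open>tooth\<close> is 0 on \<open>[0, 1/3]\<close> and 1 on \<open>[2/3, 1]\<close>,
  so that \<open>tooth (3 ^ k * t)\<close> reads off the \<open>k\<close>-th ternary digit of a point \<open>t\<close> of the Cantor set.
\<close>

definition tooth :: "real \<Rightarrow> real" where
  "tooth x = max 0 (min 1 (1/2 - cos (pi * x)))"

lemma tooth_bounds: "0 \<le> tooth x" "tooth x \<le> 1"
  by (auto simp: tooth_def)

lemma continuous_on_tooth: "continuous_on UNIV tooth"
  unfolding tooth_def by (intro continuous_intros)

lemma tooth_add_even: "tooth (2 * real m + x) = tooth x"
proof -
  have "cos (pi * (2 * real m + x)) = cos (pi * x + 2 * pi * real m)"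
    by (simp add: algebra_simps)
  also have "\<dots> = cos (pi * x)"
    using cos_2npi[of m] sin_2npi[of m] by (simp add: cos_add ac_simps)
  finally show ?thesis
    by (simp add: tooth_def)
qed

lemma tooth_low:
  assumes "0 \<le> x" "x \<le> 1/3"
  shows "tooth x = 0"
proof -
  have "cos (pi * (1/3)) \<le> cos (pi * x)"
    using assms by (intro cos_monotone_0_pi_le mult_left_mono) auto
  then show ?thesis
    by (simp add: tooth_def cos_60)
qed

lemma tooth_high:
  assumes "2/3 \<le> x" "x \<le> 1"
  shows "tooth x = 1"
proof -
  have "cos (pi - pi * (1 - x)) = - cos (pi * (1 - x))"
    by simp
  moreover have "pi - pi * (1 - x) = pi * x"
    by (simp add: algebra_simps)
  ultimately have "cos (pi * x) = - cos (pi * (1 - x))"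
    by simp
  moreover have "cos (pi * (1/3)) \<le> cos (pi * (1 - x))"
    using assms by (intro cos_monotone_0_pi_le mult_left_mono) auto
  ultimately show ?thesis
    by (simp add: tooth_def cos_60)
qed

text \<open>All ternary digits are 0 or 2, so the sum is a point of the Cantor set, whose digits
  \<open>tooth\<close> can read.\<close>

definition ternary :: "(nat \<Rightarrow> bool) \<Rightarrow> real" where
  "ternary b = (\<Sum>i. 2 * of_bool (b i) / 3 ^ Suc i)"

lemma ternary_summable: "summable (\<lambda>i. 2 * of_bool (b i) / 3 ^ Suc i :: real)"
proof (rule summable_comparison_test)
  show "summable (\<lambda>i. (1/3 :: real) ^ i)"
    by (rule summable_geometric) auto
  show "\<exists>N. \<forall>i\<ge>N. norm (2 * of_bool (b i) / 3 ^ Suc i :: real) \<le> (1/3) ^ i"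
    by (auto simp: power_divide of_bool_def divide_simps)
qed

lemma ternary_bounds: "0 \<le> ternary b" "ternary b \<le> 1"
proof -
  show "0 \<le> ternary b"
    unfolding ternary_def by (intro suminf_nonneg ternary_summable) auto
  have "(\<lambda>i. (2/3) * (1/3) ^ i) sums ((2/3) * (1 / (1 - 1/3 :: real)))"
    by (intro sums_mult geometric_sums) auto
  then have "(\<lambda>i. 2 / 3 ^ Suc i :: real) sums 1"
    by (simp add: power_divide)
  then show "ternary b \<le> 1"
    unfolding ternary_def
    by (intro order_trans[OF suminf_le[OF _ ternary_summable]])
       (auto simp: sums_iff of_bool_def divide_simps)
qed

text \<open>Multiplying by 3 moves the leading digit in front of the ternary point as an even
  integer, to which \<open>tooth\<close> is blind.\<close>

lemma ternary_shift: "3 * ternary b = 2 * of_bool (b 0) + ternary (\<lambda>i. b (Suc i))"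
proof -
  have "ternary b = 2 * of_bool (b 0) / 3 + (\<Sum>i. 2 * of_bool (b (Suc i)) / 3 ^ Suc (Suc i))"
    unfolding ternary_def using suminf_split_head[OF ternary_summable[of b]] by simp
  also have "(\<Sum>i. 2 * of_bool (b (Suc i)) / 3 ^ Suc (Suc i)) = (1/3) * ternary (\<lambda>i. b (Suc i))"
    unfolding ternary_def by (subst suminf_mult[symmetric, OF ternary_summable]) simp
  finally show ?thesis by simp
qed

text \<open>A leading digit 0 leaves the point in [0, 1/3], a leading digit 2 puts it in
  [2/3, 1].\<close>

lemma tooth_ternary_0: "tooth (ternary b) = of_bool (b 0)"
  using ternary_shift[of b] ternary_bounds[of "\<lambda>i. b (Suc i)"]
  by (cases "b 0") (auto intro!: tooth_low tooth_high)

lemma tooth_ternary: "tooth (3 ^ k * ternary b) = of_bool (b k)"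
proof -
  \<comment> \<open>The \<open>k\<close> digits moved in front of the ternary point form an even
    integer, since each of them is even.\<close>
  have "\<exists>m. 3 ^ k * ternary b = 2 * real m + ternary (\<lambda>i. b (i + k))"
  proof (induction k)
    case (Suc k)
    then obtain m where m: "3 ^ k * ternary b = 2 * real m + ternary (\<lambda>i. b (i + k))"
      by blast
    have "3 ^ Suc k * ternary b = 3 * (3 ^ k * ternary b)"
      by simp
    also have "\<dots> = 2 * real (3 * m + of_bool (b k)) + ternary (\<lambda>i. b (i + Suc k))"
      unfolding m using ternary_shift[of "\<lambda>i. b (i + k)"] by simp
    finally show ?case by blast
  qed auto
  then show ?thesis
    using tooth_ternary_0[of "\<lambda>i. b (i + k)"] by (auto simp: tooth_add_even)
qed

lemma binary_expansion:
  fixes x :: real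
  assumes "0 \<le> x" "x \<le> 1"
  obtains b :: "nat \<Rightarrow> bool" where "(\<lambda>j. of_bool (b j) / 2 ^ Suc j) sums x"
proof -
  \<comment> \<open>The doubling map, with \<open>T 1 = 1\<close>: the interval [0, 1] is invariant,
    and the number 1 is expanded with all digits equal to 1.\<close>
  define T where "T y = (if y \<ge> 1/2 then 2 * y - 1 else 2 * y)" for y :: real
  define X where "X n = (T ^^ n) x" for n
  define b where "b n \<longleftrightarrow> X n \<ge> 1/2" for n
  have X: "0 \<le> X n \<and> X n \<le> 1" for n
    by (induction n) (use assms in \<open>auto simp: X_def T_def\<close>)
  have partial: "(\<Sum>j<n. of_bool (b j) / 2 ^ Suc j) = x - X n / 2 ^ n" for n
    by (induction n) (auto simp: X_def T_def b_def field_simps)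
  have "(\<lambda>n. X n / 2 ^ n) \<longlonglongrightarrow> 0"
  proof (rule Lim_null_comparison)
    show "\<forall>\<^sub>F n in sequentially. norm (X n / 2 ^ n) \<le> (1/2) ^ n"
      using X by (auto simp: power_divide divide_right_mono)
    show "(\<lambda>n. (1/2 :: real) ^ n) \<longlonglongrightarrow> 0"
      by (rule LIMSEQ_realpow_zero) auto
  qed
  then have "(\<lambda>n. x - X n / 2 ^ n) \<longlonglongrightarrow> x - 0"
    by (intro tendsto_intros)
  then have "(\<lambda>j. of_bool (b j) / 2 ^ Suc j) sums x"
    unfolding sums_def partial by simp
  then show ?thesis by (rule that)
qed

text \<open>For \<open>t\<close> in the Cantor set and \<open>k < m\<close>, the ternary digits at
  the positions congruent to \<open>k\<close> modulo \<open>m\<close> become the binary digits of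
  coordinate \<open>k\<close>.\<close>

definition schoenberg :: "nat \<Rightarrow> nat \<Rightarrow> real \<Rightarrow> real" where
  "schoenberg m k t = (\<Sum>j. tooth (3 ^ (m * j + k) * t) / 2 ^ Suc j)"

lemma continuous_on_schoenberg: "continuous_on UNIV (schoenberg m k)"
proof -
  have *: "summable (\<lambda>j. (1/2 :: real) ^ Suc j)"
    by (subst summable_Suc_iff) simp
  have "uniform_limit UNIV (\<lambda>n t. \<Sum>j<n. tooth (3 ^ (m * j + k) * t) / 2 ^ Suc j)
          (schoenberg m k) sequentially"
    unfolding schoenberg_def
    by (rule Weierstrass_m_test[OF _ *])
       (use tooth_bounds in \<open>auto simp: power_divide divide_right_mono simp del: power_Suc\<close>)
  then show ?thesis
    by (rule uniform_limit_theorem[rotated])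
       (auto intro!: continuous_intros always_eventually
          continuous_on_compose2[OF continuous_on_tooth] simp del: power_Suc)
qed

lemma schoenberg_surj:
  assumes x: "\<And>k. k < m \<Longrightarrow> 0 \<le> x k \<and> x k \<le> 1"
  obtains t where "0 \<le> t" "t \<le> 1" "\<And>k. k < m \<Longrightarrow> schoenberg m k t = x k"
proof -
  have "\<exists>b :: nat \<Rightarrow> bool. k < m \<longrightarrow> (\<lambda>j. of_bool (b j) / 2 ^ Suc j) sums x k" for k
    using x binary_expansion[of "x k"] by metis
  then obtain b :: "nat \<Rightarrow> nat \<Rightarrow> bool"
    where b: "\<And>k. k < m \<Longrightarrow> (\<lambda>j. of_bool (b k j) / 2 ^ Suc j) sums x k"
    by metis
  \<comment> \<open>Interleaves the expansions: digit number \<open>m * j + k\<close> of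
    \<open>t\<close> is the \<open>j\<close>-th binary digit of \<open>x k\<close>.\<close>
  define t where "t = ternary (\<lambda>i. b (i mod m) (i div m))"
  have "schoenberg m k t = x k" if "k < m" for k
    using b[OF that] that unfolding schoenberg_def t_def tooth_ternary
    by (simp add: sums_iff)
  then show ?thesis
    using that[of t] ternary_bounds unfolding t_def by blast
qed

lemma space_filling_curve:
  fixes R :: real
  assumes "R > 0"
  obtains \<phi> :: "real \<Rightarrow> 'a::euclidean_space"
    where "continuous_on UNIV \<phi>" "cball 0 R \<subseteq> \<phi> ` {0..1}"
proof -
  obtain e :: "'a \<Rightarrow> nat" where e: "bij_betw e Basis {0..<DIM('a)}"
    using ex_bij_betw_finite_nat[OF finite_Basis] by blast
  \<comment> \<open>Rescales the coordinates from [0, 1] to [-R, R], so that the curve fills a cube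
    containing the ball.\<close>
  define \<phi> :: "real \<Rightarrow> 'a"
    where "\<phi> t = (\<Sum>i\<in>Basis. (R * (2 * schoenberg DIM('a) (e i) t - 1)) *\<^sub>R i)" for t
  show thesis
  proof
    show "continuous_on UNIV \<phi>"
      unfolding \<phi>_def by (intro continuous_intros continuous_on_schoenberg)
    show "cball 0 R \<subseteq> \<phi> ` {0..1}"
    proof
      fix y :: 'a
      assume y: "y \<in> cball 0 R"
      define x where "x k = (y \<bullet> inv_into Basis e k / R + 1) / 2" for k
      have "0 \<le> x k \<and> x k \<le> 1" if "k < DIM('a)" for k
      proof -
        have "inv_into Basis e k \<in> Basis"
          using that e by (metis atLeast0LessThan bij_betw_def inv_into_into lessThan_iff)
        then have "\<bar>y \<bullet> inv_into Basis e k\<bar> \<le> R"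
          using y Basis_le_norm[of "inv_into Basis e k" y] by auto
        then show ?thesis
          using assms by (auto simp: x_def field_simps abs_le_iff)
      qed
      then obtain t where t: "0 \<le> t" "t \<le> 1" "\<And>k. k < DIM('a) \<Longrightarrow> schoenberg DIM('a) k t = x k"
        using schoenberg_surj[of "DIM('a)" x] by blast
      have "\<phi> t = (\<Sum>i\<in>Basis. (y \<bullet> i) *\<^sub>R i)"
        unfolding \<phi>_def
      proof (rule sum.cong[OF refl])
        fix i :: 'a
        assume i: "i \<in> Basis"
        have "e i < DIM('a)" "inv_into Basis e (e i) = i"
          using e i by (auto simp: bij_betw_def)
        then have "schoenberg DIM('a) (e i) t = (y \<bullet> i / R + 1) / 2"
          using t(3)[of "e i"] by (simp only: x_def)
        then have "R * (2 * schoenberg DIM('a) (e i) t - 1) = y \<bullet> i"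
          using assms by (simp add: field_simps)
        then show "(R * (2 * schoenberg DIM('a) (e i) t - 1)) *\<^sub>R i = (y \<bullet> i) *\<^sub>R i"
          by simp
      qed
      then have "\<phi> t = y"
        by (simp add: euclidean_representation)
      then show "y \<in> \<phi> ` {0..1}"
        using t by auto
    qed
  qed
qed

text \<open>
  Lifting the measures along a space-filling curve to the real line reduces weak compactness
  to Helly's selection theorem.
\<close>

lemma pmf_compactness:
  fixes p :: "nat \<Rightarrow> 'a::euclidean_space pmf"
  assumes F: "compact F" and p: "\<And>n. set_pmf (p n) \<subseteq> F"
  obtains \<nu> :: "'a measure" and \<sigma> :: "nat \<Rightarrow> nat"
  where "prob_space \<nu>" "sets \<nu> = sets borel" "emeasure \<nu> F = 1" "strict_mono \<sigma>"
    "\<And>h :: 'a \<Rightarrow> real. continuous_on UNIV h \<Longrightarrow> bounded (range h) \<Longrightarrow>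
       (\<lambda>n. measure_pmf.expectation (p (\<sigma> n)) h) \<longlonglongrightarrow> integral\<^sup>L \<nu> h"
proof -
  obtain R where "R > 0" and R: "F \<subseteq> cball 0 R"
    using compact_imp_bounded[OF F] unfolding bounded_pos by (metis mem_cball_0 subsetI)
  obtain \<phi> :: "real \<Rightarrow> 'a" where \<phi>: "continuous_on UNIV \<phi>" "cball 0 R \<subseteq> \<phi> ` {0..1}"
    using space_filling_curve[OF \<open>R > 0\<close>] by blast
  have [measurable]: "\<phi> \<in> borel_measurable borel"
    using \<phi>(1) by (rule borel_measurable_continuous_onI)
  \<comment> \<open>\<open>\<psi>\<close> will pick a preimage under the curve. All sets are
    measurable for \<open>measure_pmf\<close>, so an arbitrary choice is measurable.\<close>
  have "\<forall>x\<in>F. \<exists>t. t \<in> {0..1} \<and> \<phi> t = x"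
    using \<phi>(2) R by blast
  then obtain \<psi> where \<psi>: "\<And>x. x \<in> F \<Longrightarrow> \<psi> x \<in> {0..1} \<and> \<phi> (\<psi> x) = x"
    by metis
  define M where "M n = distr (measure_pmf (p n)) borel \<psi>" for n
  have M: "real_distribution (M n)" for n
    unfolding M_def by (intro prob_space.real_distribution_distr measure_pmf.prob_space_axioms) auto
  have M_int: "integral\<^sup>L (M n) g = measure_pmf.expectation (p n) (\<lambda>x. g (\<psi> x))"
    if [measurable]: "g \<in> borel_measurable borel" for g :: "real \<Rightarrow> real" and n
    unfolding M_def by (rule integral_distr) auto
  \<comment> \<open>All lifted measures live on [0, 1], so the sequence is tight and Helly's theorem
    applies.\<close>
  have "measure (M n) {-1<..2} = 1" for n
  proof -
    interpret real_distribution "M n" by (rule M)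
    have "AE x in p n. \<psi> x \<in> {-1<..2}"
      using p \<psi> by (fastforce simp: AE_measure_pmf_iff)
    then have "AE x in M n. x \<in> {-1<..2}"
      unfolding M_def by (subst AE_distr_iff) auto
    then show ?thesis
      by (subst prob_eq_1) auto
  qed
  then have "tight M"
    unfolding tight_def using M
    by (intro conjI allI impI exI[of _ "-1::real"] exI[of _ "2::real"]) auto
  then obtain \<sigma> N where \<sigma>: "strict_mono \<sigma>" and N: "real_distribution N"
    and conv: "weak_conv_m (\<lambda>n. M (\<sigma> n)) N"
    using tight_imp_convergent_subsubsequence[of M id] by (auto simp: strict_mono_id o_def)
  interpret N: real_distribution N by (rule N)
  define \<nu> where "\<nu> = distr N borel \<phi>"
  have prob: "prob_space \<nu>"
    unfolding \<nu>_def by (intro N.prob_space_distr) auto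
  interpret \<nu>: prob_space \<nu> by (rule prob)
  have sets: "sets \<nu> = sets borel"
    by (simp add: \<nu>_def)
  have lim: "(\<lambda>n. measure_pmf.expectation (p (\<sigma> n)) h) \<longlonglongrightarrow> integral\<^sup>L \<nu> h"
    if h: "continuous_on UNIV h" and h_bdd: "bounded (range h)" for h :: "'a \<Rightarrow> real"
  proof -
    obtain B where B: "\<And>x. \<bar>h x\<bar> \<le> B"
      using h_bdd by (auto simp: bounded_iff)
    have [measurable]: "h \<in> borel_measurable borel"
      using h by (rule borel_measurable_continuous_onI)
    have "continuous_on UNIV (\<lambda>t. h (\<phi> t))"
      by (rule continuous_on_compose2[OF h \<phi>(1)]) auto
    then have "(\<lambda>n. integral\<^sup>L (M (\<sigma> n)) (\<lambda>t. h (\<phi> t))) \<longlonglongrightarrow> integral\<^sup>L N (\<lambda>t. h (\<phi> t))"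
      using B M N conv
      by (intro weak_conv_imp_integral_bdd_continuous_conv[where B = B])
         (auto simp: continuous_on_eq_continuous_at)
    \<comment> \<open>Pushing forward along \<open>\<psi>\<close> and then along
      \<open>\<phi>\<close> returns the original measure, as the composition is the identity on
      \<open>F\<close>.\<close>
    moreover have "integral\<^sup>L (M (\<sigma> n)) (\<lambda>t. h (\<phi> t)) = measure_pmf.expectation (p (\<sigma> n)) h" for n
    proof -
      have "measure_pmf.expectation (p (\<sigma> n)) (\<lambda>x. h (\<phi> (\<psi> x))) = measure_pmf.expectation (p (\<sigma> n)) h"
        using p \<psi> by (intro integral_cong_AE) (fastforce simp: AE_measure_pmf_iff)+
      then show ?thesis
        by (simp add: M_int)
    qed
    moreover have "integral\<^sup>L N (\<lambda>t. h (\<phi> t)) = integral\<^sup>L \<nu> h"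
      unfolding \<nu>_def by (rule integral_distr[symmetric]) auto
    ultimately show ?thesis
      by simp
  qed
  have "F \<noteq> {}"
    using p[of 0] set_pmf_not_empty[of "p 0"] by blast
  \<comment> \<open>The truncated distance to \<open>F\<close> has integral 0 for every
    \<open>p n\<close>, hence for the limit as well; so \<open>\<nu>\<close> is carried by the
    closed set \<open>F\<close>.\<close>
  define h where "h x = min 1 (infdist x F)" for x
  have h: "continuous_on UNIV h"
    unfolding h_def by (intro continuous_intros)
  have [measurable]: "h \<in> borel_measurable borel"
    using h by (rule borel_measurable_continuous_onI)
  have h_bound: "0 \<le> h x \<and> h x \<le> 1" for x
    by (auto simp: h_def infdist_nonneg)
  have "measure_pmf.expectation (p n) h = 0" for n
    using p[of n] by (intro integral_eq_zero_AE) (auto simp: AE_measure_pmf_iff h_def subset_iff)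
  moreover have "(\<lambda>n. measure_pmf.expectation (p (\<sigma> n)) h) \<longlonglongrightarrow> integral\<^sup>L \<nu> h"
    using h_bound by (intro lim[OF h] boundedI[of _ 1]) auto
  ultimately have "integral\<^sup>L \<nu> h = 0"
    by (simp add: LIMSEQ_const_iff)
  moreover have "integrable \<nu> h"
    using h_bound sets
    by (intro \<nu>.integrable_const_bound[where B = 1]) (auto simp: measurable_cong_sets[OF sets refl])
  ultimately have "AE x in \<nu>. h x = 0"
    using h_bound by (subst (asm) integral_nonneg_eq_0_iff_AE) auto
  moreover have "x \<in> F" if "h x = 0" for x
    using that F \<open>F \<noteq> {}\<close> in_closed_iff_infdist_zero[of F x] compact_imp_closed[OF F]
    by (auto simp: h_def min_def split: if_splits)
  ultimately have "AE x in \<nu>. x \<in> F"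
    by auto
  then have "emeasure \<nu> F = 1"
    using compact_imp_closed[OF F] sets by (intro \<nu>.emeasure_eq_1_AE) auto
  then show thesis
    using that prob sets \<sigma> lim by blast
qed

section \<open>Kernel sums and the Cauchy-Schwarz inequality\<close>

context rkhs
begin

definition kernel_at :: "'a \<Rightarrow> 'a \<Rightarrow> complex" where
  "kernel_at w = (\<lambda>z. if z \<in> X then K z w else 0)"

lemma kernel_at_mem: "w \<in> X \<Longrightarrow> kernel_at w \<in> H"
  unfolding kernel_at_def by (rule kernel_mem)

lemma ip_zero_left: "h \<in> H \<Longrightarrow> ip (\<lambda>x. 0) h = 0"
  using ip_scale_left[of "\<lambda>x. 0" h 0] zero_mem by simp

lemma ip_zero_right: "h \<in> H \<Longrightarrow> ip h (\<lambda>x. 0) = 0"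
  using ip_commute[of "\<lambda>x. 0" h] ip_zero_left zero_mem by simp

lemma ip_add_right:
  "f \<in> H \<Longrightarrow> g \<in> H \<Longrightarrow> h \<in> H \<Longrightarrow> ip h (\<lambda>x. f x + g x) = ip h f + ip h g"
  using ip_commute[of "\<lambda>x. f x + g x" h] ip_commute[of f h] ip_commute[of g h] ip_add_left add_mem
  by simp

lemma ip_scale_right:
  "f \<in> H \<Longrightarrow> h \<in> H \<Longrightarrow> ip h (\<lambda>x. c * f x) = cnj c * ip h f"
  using ip_commute[of "\<lambda>x. c * f x" h] ip_commute[of f h] ip_scale_left scale_mem by simp

lemma ip_self_real: "f \<in> H \<Longrightarrow> ip f f = of_real (Re (ip f f))"
  using ip_commute[of f f] by (metis Reals_cnj_iff of_real_Re)

lemma ip_norm_sq: "f \<in> H \<Longrightarrow> (ip_norm ip f)\<^sup>2 = Re (ip f f)"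
  using ip_nonneg by (simp add: ip_norm_def)

lemma norm_sq_add:
  assumes "f \<in> H" "g \<in> H"
  shows "Re (ip (\<lambda>x. f x + c * g x) (\<lambda>x. f x + c * g x)) =
    Re (ip f f) + 2 * Re (cnj c * ip f g) + (cmod c)\<^sup>2 * Re (ip g g)"
proof -
  have "ip (\<lambda>x. f x + c * g x) (\<lambda>x. f x + c * g x) =
      ip f f + cnj c * ip f g + (c * ip g f + c * cnj c * ip g g)"
    using assms
    by (simp add: ip_add_left ip_add_right ip_scale_left ip_scale_right add_mem scale_mem
        algebra_simps)
  moreover have "c * ip g f = cnj (cnj c * ip f g)"
    using ip_commute[OF assms] by simp
  moreover have "Re (c * cnj c * ip g g) = (cmod c)\<^sup>2 * Re (ip g g)"
    by (simp add: complex_norm_square[symmetric] flip: of_real_power)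
  ultimately show ?thesis
    by (simp only: plus_complex.sel cnj.sel)
qed

lemma cauchy_schwarz:
  assumes "f \<in> H" "g \<in> H"
  shows "(cmod (ip f g))\<^sup>2 \<le> Re (ip f f) * Re (ip g g)"
proof (cases "Re (ip g g) = 0")
  case True
  then have "g = (\<lambda>x. 0)"
    using ip_definite[OF assms(2)] ip_self_real[OF assms(2)] by simp
  then show ?thesis
    using ip_zero_right[OF assms(1)] ip_nonneg zero_mem assms(1) by (simp add: ip_zero_left)
next
  case False
  define b where "b = Re (ip g g)"
  have "b > 0"
    using False ip_nonneg[OF assms(2)] by (simp add: b_def)
  \<comment> \<open>The minimiser of the squared norm of \<open>f + c g\<close>.\<close>
  define c where "c = - ip f g / of_real b"
  have "cnj c * ip f g = - of_real ((cmod (ip f g))\<^sup>2 / b)"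
    using complex_norm_square[of "ip f g"] by (simp add: c_def mult.commute)
  moreover have "(cmod c)\<^sup>2 * b = (cmod (ip f g))\<^sup>2 / b"
    using \<open>b > 0\<close> by (simp add: c_def norm_divide power_divide power2_eq_square)
  moreover have "0 \<le> Re (ip (\<lambda>x. f x + c * g x) (\<lambda>x. f x + c * g x))"
    using assms by (intro ip_nonneg add_mem scale_mem)
  ultimately have "(cmod (ip f g))\<^sup>2 / b \<le> Re (ip f f)"
    using norm_sq_add[OF assms, of c] by (simp add: b_def)
  then show ?thesis
    using \<open>b > 0\<close> by (simp add: b_def pos_divide_le_eq)
qed

lemma sum_mem:
  assumes "finite I" "\<And>i. i \<in> I \<Longrightarrow> f i \<in> H"
  shows "(\<lambda>x. \<Sum>i\<in>I. c i * f i x) \<in> H"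
  using assms by (induction I) (auto intro!: zero_mem add_mem scale_mem)

lemma ip_sum_right:
  assumes "finite I" "\<And>i. i \<in> I \<Longrightarrow> f i \<in> H" "h \<in> H"
  shows "ip h (\<lambda>x. \<Sum>i\<in>I. c i * f i x) = (\<Sum>i\<in>I. cnj (c i) * ip h (f i))"
  using assms
  by (induction I) (simp_all add: ip_zero_right ip_add_right ip_scale_right sum_mem scale_mem)

text \<open>The potential in \<open>H\<close> of the discrete real measure with mass
  \<open>c i\<close> at \<open>p i\<close>. Pairing with it integrates against this measure, and its
  squared norm is the energy.\<close>

definition kernel_sum :: "'i set \<Rightarrow> ('i \<Rightarrow> real) \<Rightarrow> ('i \<Rightarrow> 'a) \<Rightarrow> 'a \<Rightarrow> complex" where
  "kernel_sum I c p = (\<lambda>z. \<Sum>i\<in>I. of_real (c i) * kernel_at (p i) z)"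

lemma kernel_sum_eq:
  "z \<in> X \<Longrightarrow> kernel_sum I c p z = (\<Sum>i\<in>I. of_real (c i) * K z (p i))"
  by (simp add: kernel_sum_def kernel_at_def)

lemma kernel_sum_mem:
  "finite I \<Longrightarrow> p ` I \<subseteq> X \<Longrightarrow> kernel_sum I c p \<in> H"
  unfolding kernel_sum_def by (intro sum_mem kernel_at_mem) auto

lemma ip_kernel_sum:
  assumes "finite I" "p ` I \<subseteq> X" "f \<in> H"
  shows "ip f (kernel_sum I c p) = (\<Sum>i\<in>I. of_real (c i) * f (p i))"
proof -
  have "ip f (kernel_at (p i)) = f (p i)" if "i \<in> I" for i
    unfolding kernel_at_def using that assms by (intro reproducing) auto
  moreover have "ip f (kernel_sum I c p) = (\<Sum>i\<in>I. cnj (of_real (c i)) * ip f (kernel_at (p i)))"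
    unfolding kernel_sum_def using assms by (intro ip_sum_right kernel_at_mem) auto
  ultimately show ?thesis
    by simp
qed

lemma norm_sq_kernel_sum:
  assumes "finite I" "p ` I \<subseteq> X"
  shows "Re (ip (kernel_sum I c p) (kernel_sum I c p)) =
    (\<Sum>i\<in>I. \<Sum>j\<in>I. c i * c j * Re (K (p i) (p j)))"
  using assms
  by (subst ip_kernel_sum)
     (auto simp: kernel_sum_mem kernel_sum_eq sum_distrib_left mult.assoc image_subset_iff
       intro!: sum.cong)

lemma kernel_cnj: "z \<in> X \<Longrightarrow> w \<in> X \<Longrightarrow> K w z = cnj (K z w)"
  using ip_commute[OF kernel_at_mem kernel_at_mem, of w z]
    reproducing[OF kernel_at_mem, of w z] reproducing[OF kernel_at_mem, of z w]
  by (simp add: kernel_at_def)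

end

section \<open>Cauchy-Schwarz against a probability measure\<close>

lemma (in finite_measure) integral_simple_compose:
  fixes g :: "'c \<Rightarrow> 'b::{banach, second_countable_topology}"
  assumes "simple_function M Y"
  shows "(\<integral>x. g (Y x) \<partial>M) = (\<Sum>y\<in>Y ` space M. measure M (Y -` {y} \<inter> space M) *\<^sub>R g y)"
proof -
  have fin: "finite (Y ` space M)" and meas: "\<And>y. Y -` {y} \<inter> space M \<in> sets M"
    using assms by (auto simp: simple_function_def intro: simple_functionD)
  have "(\<integral>x. g (Y x) \<partial>M) =
      (\<integral>x. (\<Sum>y\<in>Y ` space M. indicator (Y -` {y} \<inter> space M) x *\<^sub>R g y) \<partial>M)"
  proof (rule Bochner_Integration.integral_cong[OF refl])
    fix x assume x: "x \<in> space M"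
    have "(\<Sum>y\<in>Y ` space M. indicator (Y -` {y} \<inter> space M) x *\<^sub>R g y) =
        (\<Sum>y\<in>Y ` space M. if y = Y x then g y else 0)"
      using x by (intro sum.cong) (auto simp: indicator_def)
    then show "g (Y x) = (\<Sum>y\<in>Y ` space M. indicator (Y -` {y} \<inter> space M) x *\<^sub>R g y)"
      using fin x by (simp add: sum.delta)
  qed
  also have "\<dots> = (\<Sum>y\<in>Y ` space M. measure M (Y -` {y} \<inter> space M) *\<^sub>R g y)"
    using fin meas
    by (subst Bochner_Integration.integral_sum)
       (auto intro!: integrable_scaleR_left simp: emeasure_eq_measure less_top[symmetric])
  finally show ?thesis .
qed

text \<open>
  Approximating \<open>Z\<close> by simple functions replaces the element \<open>\<integral> K(_, Z y) dM(y)\<close> of \<open>H\<close> by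
  finite sums of kernel functions, so that no integral with values in \<open>H\<close> is needed.
\<close>

lemma kernel_cauchy_schwarz_integral:
  fixes X :: "'a::euclidean_space set" and M :: "'m measure" and Z :: "'m \<Rightarrow> 'a"
  assumes "rkhs X H ip K" and "prob_space M"
    and Z: "Z \<in> borel_measurable M" "\<And>x. x \<in> space M \<Longrightarrow> Z x \<in> C"
    and C: "compact C" "convex C" "C \<subseteq> X"
    and K: "continuous_on (X \<times> X) (\<lambda>(z, w). K z w)"
    and f: "f \<in> H" "continuous_on X f"
  shows "(cmod (\<integral>x. f (Z x) \<partial>M))\<^sup>2 \<le>
    (ip_norm ip f)\<^sup>2 * Re (\<integral>x. (\<integral>y. K (Z x) (Z y) \<partial>M) \<partial>M)"
proof -
  interpret rkhs X H ip K by fact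
  interpret prob_space M by fact
  have "C \<noteq> {}"
    using Z(2) not_empty by blast
  obtain S where S: "\<And>n. simple_function M (S n)" "\<And>x. x \<in> space M \<Longrightarrow> (\<lambda>n. S n x) \<longlonglongrightarrow> Z x"
    using borel_measurable_implies_sequence_metric[OF Z(1), of 0] by blast
  \<comment> \<open>The simple approximations may leave \<open>C\<close>. Projecting them onto this
    convex set keeps their values where \<open>f\<close> and \<open>K\<close> are bounded, and the
    limit is still \<open>Z\<close> because the projection is continuous and fixes
    \<open>C\<close>.\<close>
  define Y where "Y n x = closest_point C (S n x)" for n x
  have Y_simple: "simple_function M (Y n)" for n
    using simple_function_compose1[OF S(1)[of n], of "closest_point C"] by (simp add: Y_def[abs_def])
  have Y_C: "Y n x \<in> C" for n x
    using C \<open>C \<noteq> {}\<close> by (simp add: Y_def closest_point_in_set compact_imp_closed)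
  have Y_lim: "(\<lambda>n. Y n x) \<longlonglongrightarrow> Z x" if "x \<in> space M" for x
  proof -
    have "isCont (closest_point C) (Z x)"
      using C \<open>C \<noteq> {}\<close> by (intro continuous_at_closest_point) (auto intro: compact_imp_closed)
    then have "(\<lambda>n. Y n x) \<longlonglongrightarrow> closest_point C (Z x)"
      unfolding Y_def using S(2)[OF that] by (rule isCont_tendsto_compose)
    then show ?thesis
      using Z(2)[OF that] by (simp add: closest_point_self)
  qed
  obtain B where B: "\<And>z. z \<in> C \<Longrightarrow> cmod (f z) \<le> B"
    using compact_imp_bounded[OF compact_continuous_image[OF continuous_on_subset[OF f(2) C(3)] C(1)]]
    by (auto simp: bounded_iff)
  have "bounded ((\<lambda>(z, w). K z w) ` (C \<times> C))"
    using C
    by (intro compact_imp_bounded compact_continuous_image compact_Times continuous_on_subset[OF K])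
       auto
  then obtain D where D: "\<And>z w. z \<in> C \<Longrightarrow> w \<in> C \<Longrightarrow> cmod (K z w) \<le> D"
    by (auto simp: bounded_iff)
  have f_lim: "(\<lambda>n. f (Y n x)) \<longlonglongrightarrow> f (Z x)" if "x \<in> space M" for x
    using that Y_C C(3) Z(2)
    by (intro continuous_on_tendsto_compose[OF f(2) Y_lim] always_eventually) auto
  have K_lim: "(\<lambda>n. K (Y n x) (Y n y)) \<longlonglongrightarrow> K (Z x) (Z y)" if "x \<in> space M" "y \<in> space M" for x y
    using continuous_on_tendsto_compose[OF K tendsto_Pair[OF Y_lim Y_lim], OF that] that Y_C C(3) Z(2)
    by (simp add: always_eventually subset_iff)
  have meas_Y: "(\<lambda>x. g (Y n x)) \<in> borel_measurable M" for g :: "'a \<Rightarrow> complex" and n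
    using simple_function_compose1[OF Y_simple[of n], of g] by (rule borel_measurable_simple_function)
  have inner_lim: "(\<lambda>n. \<integral>y. K (Y n x) (Y n y) \<partial>M) \<longlonglongrightarrow> (\<integral>y. K (Z x) (Z y) \<partial>M)" if "x \<in> space M" for x
  proof (rule integral_dominated_convergence[where w = "\<lambda>_. D"])
    show "(\<lambda>y. K (Z x) (Z y)) \<in> borel_measurable M"
      by (intro borel_measurable_LIMSEQ_metric[OF _ K_lim[OF that]] meas_Y)
  qed (use K_lim[OF that] meas_Y D Y_C in auto)
  have inner_meas: "(\<lambda>x. \<integral>y. K (Y n x) (Y n y) \<partial>M) \<in> borel_measurable M" for n
    by (rule meas_Y)
  have inner_bound: "cmod (\<integral>y. K (Y n x) (Y n y) \<partial>M) \<le> D" for n x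
  proof -
    have [measurable]: "(\<lambda>y. K (Y n x) (Y n y)) \<in> borel_measurable M"
      by (rule meas_Y)
    have "(\<integral>y. cmod (K (Y n x) (Y n y)) \<partial>M) \<le> D"
      using D Y_C by (intro integral_le_const integrable_const_bound[where B = D]) auto
    then show ?thesis
      using integral_norm_bound[of M "\<lambda>y. K (Y n x) (Y n y)"] by linarith
  qed
  have lim1: "(\<lambda>n. \<integral>x. f (Y n x) \<partial>M) \<longlonglongrightarrow> (\<integral>x. f (Z x) \<partial>M)"
  proof (rule integral_dominated_convergence[where w = "\<lambda>_. B"])
    show "(\<lambda>x. f (Z x)) \<in> borel_measurable M"
      by (intro borel_measurable_LIMSEQ_metric[OF _ f_lim] meas_Y)
  qed (use f_lim meas_Y B Y_C in auto)
  have lim2: "(\<lambda>n. \<integral>x. (\<integral>y. K (Y n x) (Y n y) \<partial>M) \<partial>M) \<longlonglongrightarrow> (\<integral>x. (\<integral>y. K (Z x) (Z y) \<partial>M) \<partial>M)"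
  proof (rule integral_dominated_convergence[where w = "\<lambda>_. D"])
    show "(\<lambda>x. \<integral>y. K (Z x) (Z y) \<partial>M) \<in> borel_measurable M"
      by (intro borel_measurable_LIMSEQ_metric[OF _ inner_lim] inner_meas)
  qed (use inner_lim inner_meas inner_bound in auto)
  \<comment> \<open>For simple maps both sides are finite sums, and the claim is Cauchy-Schwarz for
    \<open>f\<close> and a kernel sum whose masses are the measures of the level sets.\<close>
  have "(cmod (\<integral>x. f (Y n x) \<partial>M))\<^sup>2 \<le>
    (ip_norm ip f)\<^sup>2 * Re (\<integral>x. (\<integral>y. K (Y n x) (Y n y) \<partial>M) \<partial>M)" for n
  proof -
    define I where "I = Y n ` space M"
    define c where "c y = measure M (Y n -` {y} \<inter> space M)" for y
    have I: "finite I" "(\<lambda>y. y) ` I \<subseteq> X"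
      using Y_simple[of n] Y_C C(3) by (auto simp: I_def simple_function_def)
    have int: "(\<integral>x. g (Y n x) \<partial>M) = (\<Sum>y\<in>I. of_real (c y) * g y)" for g :: "'a \<Rightarrow> complex"
      using integral_simple_compose[OF Y_simple[of n], of g]
      by (simp add: I_def c_def scaleR_conv_of_real)
    have "(\<integral>x. f (Y n x) \<partial>M) = ip f (kernel_sum I c (\<lambda>y. y))"
      using I f by (simp add: int ip_kernel_sum)
    moreover have "Re (\<integral>x. (\<integral>y. K (Y n x) (Y n y) \<partial>M) \<partial>M) =
        Re (ip (kernel_sum I c (\<lambda>y. y)) (kernel_sum I c (\<lambda>y. y)))"
      unfolding norm_sq_kernel_sum[OF I]
      by (simp add: int[of "K _"] int[of "\<lambda>x. \<Sum>y\<in>I. of_real (c y) * K x y"]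
          sum_distrib_left mult.assoc)
    ultimately show ?thesis
      using cauchy_schwarz[OF f(1) kernel_sum_mem[OF I, of c]] f(1) by (simp add: ip_norm_sq)
  qed
  then show ?thesis
    by (intro LIMSEQ_le[OF tendsto_power[OF tendsto_norm[OF lim1]]
          tendsto_mult[OF tendsto_const tendsto_Re[OF lim2]]]) auto
qed

section \<open>Unitarily invariant kernels\<close>

lemma herm_scaleR: "herm (r *\<^sub>R z) (s *\<^sub>R w) = of_real (r * s) * herm z w"
  unfolding herm_def vector_scaleR_component
  by (simp add: scaleR_conv_of_real sum_distrib_left mult_ac)

lemma cmod_herm_le: "cmod (herm z w) \<le> norm z * norm w"
proof -
  have "cmod (herm z w) \<le> (\<Sum>i\<in>UNIV. \<bar>norm (z $ i)\<bar> * \<bar>norm (w $ i)\<bar>)"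
    unfolding herm_def by (rule sum_norm_le) (simp add: norm_mult)
  also have "\<dots> \<le> norm z * norm w"
    unfolding norm_vec_def by (rule L2_set_mult_ineq)
  finally show ?thesis .
qed

lemma herm_axis: "herm (axis i a) (axis i b) = a * cnj b"
proof -
  have "herm (axis i a) (axis i b) = (\<Sum>j\<in>UNIV. if j = i then a * cnj b else 0)"
    unfolding herm_def by (rule sum.cong) (auto simp: axis_def)
  then show ?thesis by simp
qed

lemma norm_axis: "norm (axis i a) = norm a"
proof -
  have "(\<Sum>j\<in>UNIV. (norm (axis i a $ j))\<^sup>2) = (\<Sum>j\<in>UNIV. if j = i then (norm a)\<^sup>2 else 0)"
    by (rule sum.cong) (auto simp: axis_def)
  then show ?thesis
    by (simp add: norm_vec_def L2_set_def)
qed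

lemma continuous_on_herm: "continuous_on S (\<lambda>x. herm (fst x) (snd x))"
  unfolding herm_def by (intro continuous_intros)

text \<open>An instance of the Schur product theorem. Splitting one factor \<open>herm x y\<close>
  into coordinate products and absorbing \<open>x $ k\<close> into the coefficient lowers the
  exponent, so the induction runs over all \<open>c\<close>.\<close>

lemma herm_power_psd:
  fixes c :: "complex ^ 'n \<Rightarrow> complex"
  shows "0 \<le> Re (\<Sum>x\<in>A. \<Sum>y\<in>A. c x * cnj (c y) * herm x y ^ n)"
proof (induction n arbitrary: c)
  case 0
  have "(\<Sum>x\<in>A. \<Sum>y\<in>A. c x * cnj (c y)) = (\<Sum>x\<in>A. c x) * cnj (\<Sum>x\<in>A. c x)"
    by (simp add: sum_product)
  then show ?case
    by (simp add: complex_norm_square[symmetric] del: cnj_sum flip: of_real_power)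
next
  case (Suc n)
  have "herm x y ^ Suc n = (\<Sum>k\<in>UNIV. x $ k * cnj (y $ k) * herm x y ^ n)" for x y :: "complex ^ 'n"
    unfolding power_Suc sum_distrib_right[symmetric] herm_def[symmetric] ..
  then have "(\<Sum>x\<in>A. \<Sum>y\<in>A. c x * cnj (c y) * herm x y ^ Suc n) =
      (\<Sum>x\<in>A. \<Sum>y\<in>A. \<Sum>k\<in>UNIV. (c x * x $ k) * cnj (c y * y $ k) * herm x y ^ n)"
    by (simp add: sum_distrib_left mult_ac del: power_Suc)
  also have "\<dots> = (\<Sum>x\<in>A. \<Sum>k\<in>UNIV. \<Sum>y\<in>A. (c x * x $ k) * cnj (c y * y $ k) * herm x y ^ n)"
    by (intro sum.cong refl sum.swap)
  also have "\<dots> = (\<Sum>k\<in>UNIV. \<Sum>x\<in>A. \<Sum>y\<in>A. (c x * x $ k) * cnj (c y * y $ k) * herm x y ^ n)"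
    by (rule sum.swap)
  finally have "(\<Sum>x\<in>A. \<Sum>y\<in>A. c x * cnj (c y) * herm x y ^ Suc n) = \<dots>" .
  then show ?case
    by (simp only:, subst Re_sum) (intro sum_nonneg Suc.IH)
qed

context unitarily_invariant_pluriharmonic_space
begin

text \<open>The values \<open>herm z w\<close> at points of the ball exhaust the open unit disc, so
  the expansion assumed on pairs of points becomes a statement about power series on the
  disc.\<close>

lemma kernel_powser:
  obtains a :: "int \<Rightarrow> real" where "\<And>n. a n \<ge> 0" "a 0 = 1"
    "\<And>x :: complex. cmod x < 1 \<Longrightarrow> summable (\<lambda>n. of_real (a (int n)) * x ^ n)"
    "\<And>x :: complex. cmod x < 1 \<Longrightarrow> summable (\<lambda>n. of_real (a (- int (Suc n))) * x ^ Suc n)"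
    "\<And>z w. z \<in> ball 0 1 \<Longrightarrow> w \<in> ball 0 1 \<Longrightarrow>
      K z w = (\<Sum>n. of_real (a (int n)) * herm z w ^ n)
            + (\<Sum>n. of_real (a (- int (Suc n))) * cnj (herm z w) ^ Suc n)"
proof -
  obtain a :: "int \<Rightarrow> real" where a_exp: "(\<forall>n. a n \<ge> 0) \<and> a 0 = 1 \<and>
       (\<forall>z\<in>ball 0 1. \<forall>w\<in>ball 0 1.
          summable (\<lambda>n. of_real (a (int n)) * herm z w ^ n) \<and>
          summable (\<lambda>n. of_real (a (- int (Suc n))) * cnj (herm z w) ^ Suc n) \<and>
          K z w = (\<Sum>n. of_real (a (int n)) * herm z w ^ n)
                + (\<Sum>n. of_real (a (- int (Suc n))) * cnj (herm z w) ^ Suc n))"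
    using kernel_expansion by (rule exE)
  then have a: "\<And>n. a n \<ge> 0" "a 0 = 1"
    by auto
  have s: "summable (\<lambda>n. of_real (a (int n)) * herm z w ^ n)"
      "summable (\<lambda>n. of_real (a (- int (Suc n))) * cnj (herm z w) ^ Suc n)"
      "K z w = (\<Sum>n. of_real (a (int n)) * herm z w ^ n)
             + (\<Sum>n. of_real (a (- int (Suc n))) * cnj (herm z w) ^ Suc n)"
    if "z \<in> ball 0 1" "w \<in> ball 0 1" for z w
    using a_exp that by (simp_all only: Ball_def)
  have disc: "\<exists>z\<in>ball (0 :: complex ^ 'n) 1. \<exists>w\<in>ball 0 1. herm z w = x" if "cmod x < 1" for x :: complex
  proof -
    \<comment> \<open>Lies strictly between \<open>cmod x\<close> and 1, so that
      \<open>x / t\<close> and \<open>t\<close> both have modulus below 1.\<close>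
    define t where "t = (1 + cmod x) / 2"
    have t: "0 < t" "t < 1" "cmod x < t"
      using that norm_ge_zero[of x] by (auto simp: t_def add_pos_nonneg simp del: norm_ge_zero)
    obtain i :: 'n where True by blast
    have "herm (axis i (x / of_real t)) (axis i (of_real t)) = x"
      using t by (simp add: herm_axis)
    moreover have "axis i (x / of_real t) \<in> ball 0 1" "axis i (complex_of_real t) \<in> ball 0 1"
      using t by (simp_all add: norm_axis norm_divide)
    ultimately show ?thesis by blast
  qed
  show thesis
  proof (rule that[of a])
    show "a n \<ge> 0" "a 0 = 1" for n
      using a by auto
    fix x :: complex
    assume x: "cmod x < 1"
    show "summable (\<lambda>n. of_real (a (int n)) * x ^ n)"
      using disc[OF x] s(1) by metis
    \<comment> \<open>The second series is in the conjugate of \<open>herm z w\<close>, hence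
      \<open>cnj x\<close>.\<close>
    obtain z w :: "complex ^ 'n" where "z \<in> ball 0 1" "w \<in> ball 0 1" "herm z w = cnj x"
      using disc[of "cnj x"] x by (auto simp del: mem_ball mem_ball_0)
    then show "summable (\<lambda>n. of_real (a (- int (Suc n))) * x ^ Suc n)"
      using s(2)[of z w] by simp
  qed (rule s(3))
qed

text \<open>Dependence on \<open>herm z w\<close> alone gives the continuity of the kernel and lets
  dilations be moved between the variables.\<close>

lemma kernel_profile:
  obtains \<Psi> where "continuous_on (ball 0 1) \<Psi>"
    "\<And>z w. z \<in> ball 0 1 \<Longrightarrow> w \<in> ball 0 1 \<Longrightarrow> K z w = \<Psi> (herm z w)"
proof -
  obtain a :: "int \<Rightarrow> real" where "\<And>n. a n \<ge> 0" "a 0 = 1" and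
    s1: "\<And>x :: complex. cmod x < 1 \<Longrightarrow> summable (\<lambda>n. of_real (a (int n)) * x ^ n)" and
    s2: "\<And>x :: complex. cmod x < 1 \<Longrightarrow> summable (\<lambda>n. of_real (a (- int (Suc n))) * x ^ Suc n)" and
    K: "\<And>z w. z \<in> ball 0 1 \<Longrightarrow> w \<in> ball 0 1 \<Longrightarrow>
      K z w = (\<Sum>n. of_real (a (int n)) * herm z w ^ n)
            + (\<Sum>n. of_real (a (- int (Suc n))) * cnj (herm z w) ^ Suc n)"
    by (rule kernel_powser, rule that)
  \<comment> \<open>Prepends a zero constant term, so that the second series becomes an ordinary
    power series.\<close>
  define b where "b n = (if n = 0 then 0 else complex_of_real (a (- int n)))" for n
  have b: "summable (\<lambda>n. b n * x ^ n)"
    "(\<Sum>n. b n * x ^ n) = (\<Sum>n. of_real (a (- int (Suc n))) * x ^ Suc n)" if "cmod x < 1" for x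
  proof -
    have "(\<lambda>n. b (Suc n) * x ^ Suc n) sums (\<Sum>n. of_real (a (- int (Suc n))) * x ^ Suc n)"
      using summable_sums[OF s2[OF that]] by (simp add: b_def)
    then have "(\<lambda>n. b n * x ^ n) sums (\<Sum>n. of_real (a (- int (Suc n))) * x ^ Suc n)"
      by (subst (asm) sums_Suc_iff) (simp add: b_def)
    then show "summable (\<lambda>n. b n * x ^ n)"
      "(\<Sum>n. b n * x ^ n) = (\<Sum>n. of_real (a (- int (Suc n))) * x ^ Suc n)"
      by (auto simp: sums_iff)
  qed
  have cont: "continuous_on (ball 0 1) (\<lambda>x. \<Sum>n. c n * x ^ n)"
    if "\<And>x :: complex. cmod x < 1 \<Longrightarrow> summable (\<lambda>n. c n * x ^ n)" for c
  proof (rule continuous_at_imp_continuous_on, rule ballI)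
    fix x :: complex
    assume "x \<in> ball 0 1"
    then obtain t where t: "cmod x < t" "t < 1"
      using dense[of "cmod x" 1] by auto
    then have "norm (complex_of_real t) = t"
      using norm_ge_zero[of x] by (simp del: norm_ge_zero)
    with t show "isCont (\<lambda>x. \<Sum>n. c n * x ^ n) x"
      by (intro isCont_powser[of c "of_real t"] that) auto
  qed
  define \<Psi> where "\<Psi> x = (\<Sum>n. of_real (a (int n)) * x ^ n) + (\<Sum>n. b n * cnj x ^ n)" for x
  show thesis
  proof
    show "continuous_on (ball 0 1) \<Psi>"
      unfolding \<Psi>_def using s1 b(1)
      by (intro continuous_intros cont continuous_on_compose2[OF cont[of b], of _ cnj]) auto
    fix z w :: "complex ^ 'n"
    assume zw: "z \<in> ball 0 1" "w \<in> ball 0 1"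
    then have "norm z * norm w < 1"
      using mult_strict_mono[of "norm z" 1 "norm w" 1] by simp
    then have "cmod (cnj (herm z w)) < 1"
      using cmod_herm_le[of z w] by simp
    then show "K z w = \<Psi> (herm z w)"
      using K[OF zw] b(2)[of "cnj (herm z w)"] by (simp add: \<Psi>_def)
  qed
qed

lemma continuous_on_kernel: "continuous_on (ball 0 1 \<times> ball 0 1) (\<lambda>(z, w). K z w)"
proof -
  obtain \<Psi> where \<Psi>: "continuous_on (ball 0 1) \<Psi>"
    "\<And>z w. z \<in> ball 0 1 \<Longrightarrow> w \<in> ball 0 1 \<Longrightarrow> K z w = \<Psi> (herm z w)"
    by (rule kernel_profile, rule that)
  have "cmod (herm z w) < 1" if "norm z < 1" "norm w < 1" for z w :: "complex ^ 'n"
    using mult_strict_mono[of "norm z" 1 "norm w" 1] cmod_herm_le[of z w] that by simp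
  then have "continuous_on (ball 0 1 \<times> ball 0 1) (\<lambda>x :: (complex ^ 'n) \<times> _. \<Psi> (herm (fst x) (snd x)))"
    by (intro continuous_on_compose2[OF \<Psi>(1) continuous_on_herm]) auto
  then show ?thesis
    by (rule continuous_on_eq) (auto simp: \<Psi>(2))
qed

lemma scaleR_in_ball: "0 \<le> r \<Longrightarrow> r < 1 \<Longrightarrow> norm z \<le> 1 \<Longrightarrow> r *\<^sub>R z \<in> ball (0 :: complex ^ 'n) 1"
  using mult_left_mono[of "norm z" 1 r] by simp

text \<open>Both pairs of points have the same inner product. As functions of \<open>z\<close>, the
  right side is a kernel function in \<open>H\<close> and the left side makes sense on the closed
  ball; this is how potentials acquire continuous extensions.\<close>

lemma kernel_scaleR:
  assumes "0 \<le> r" "r < 1" "z \<in> ball 0 1" "norm w \<le> 1"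
  shows "K (r *\<^sub>R z) (r *\<^sub>R w) = K z (r\<^sup>2 *\<^sub>R w)"
proof -
  obtain \<Psi> where "continuous_on (ball 0 1) \<Psi>"
    and \<Psi>: "\<And>z w. z \<in> ball 0 1 \<Longrightarrow> w \<in> ball 0 1 \<Longrightarrow> K z w = \<Psi> (herm z w)"
    by (rule kernel_profile, rule that)
  have "norm z \<le> 1"
    using assms by simp
  have "r\<^sup>2 < 1"
    using assms by (simp add: power_less_one_iff abs_square_less_1)
  then have "r *\<^sub>R z \<in> ball 0 1" "r *\<^sub>R w \<in> ball 0 1" "r\<^sup>2 *\<^sub>R w \<in> ball 0 1"
    using assms \<open>norm z \<le> 1\<close> by (auto intro!: scaleR_in_ball simp del: mem_ball mem_ball_0)
  moreover have "herm (r *\<^sub>R z) (r *\<^sub>R w) = herm z (r\<^sup>2 *\<^sub>R w)"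
    using herm_scaleR[of r z r w] herm_scaleR[of 1 z "r\<^sup>2" w] by (simp add: power2_eq_square)
  ultimately show ?thesis
    using \<Psi> assms(3) by simp
qed

section \<open>Energies of finitely supported measures\<close>

text \<open>The double integral in \<open>energy\<close> for the measure \<open>p\<close>. It is
  applied only to finite supports; over an infinite one the sums take the default value 0.\<close>

definition discrete_energy :: "real \<Rightarrow> (complex ^ 'n) pmf \<Rightarrow> real" where
  "discrete_energy r p =
     (\<Sum>x\<in>set_pmf p. \<Sum>y\<in>set_pmf p. pmf p x * pmf p y * Re (K (r *\<^sub>R x) (r *\<^sub>R y)))"

text \<open>
  \<open>q n 0\<close> and \<open>q n 1\<close> are the contributions of the coefficients \<open>a n\<close> and \<open>a (- Suc n)\<close>.
\<close>

lemma discrete_energy_sums: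
  assumes fin: "finite (set_pmf p)" and p: "set_pmf p \<subseteq> cball 0 1"
  obtains q :: "nat \<Rightarrow> nat \<Rightarrow> real" where
    "\<And>n k. q n k \<ge> 0" "q 0 0 = 1" "\<And>r. 0 \<le> r \<Longrightarrow> r < 1 \<Longrightarrow>
      (\<lambda>n. q n 0 * r ^ (2 * n) + q n 1 * r ^ (2 * Suc n)) sums discrete_energy r p"
proof -
  obtain a :: "int \<Rightarrow> real" where a: "\<And>n. a n \<ge> 0" "a 0 = 1" and
    s1: "\<And>x :: complex. cmod x < 1 \<Longrightarrow> summable (\<lambda>n. of_real (a (int n)) * x ^ n)" and
    s2: "\<And>x :: complex. cmod x < 1 \<Longrightarrow> summable (\<lambda>n. of_real (a (- int (Suc n))) * x ^ Suc n)" and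
    K: "\<And>z w. z \<in> ball 0 1 \<Longrightarrow> w \<in> ball 0 1 \<Longrightarrow>
      K z w = (\<Sum>n. of_real (a (int n)) * herm z w ^ n)
            + (\<Sum>n. of_real (a (- int (Suc n))) * cnj (herm z w) ^ Suc n)"
    by (rule kernel_powser, rule that)
  \<comment> \<open>Conjugation does not change real parts, so both halves of the expansion involve
    the same numbers \<open>u n\<close>, and these are nonnegative by
    \<open>herm_power_psd\<close>.\<close>
  define u where "u n = (\<Sum>x\<in>set_pmf p. \<Sum>y\<in>set_pmf p. pmf p x * pmf p y * Re (herm x y ^ n))" for n
  define q where "q n k = (if k = 0 then a (int n) * u n else a (- int (Suc n)) * u (Suc n))"
    for n k :: nat
  have u: "u n \<ge> 0" for n
    using herm_power_psd[where c = "\<lambda>x. of_real (pmf p x)" and A = "set_pmf p" and n = n]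
    by (simp add: u_def Re_sum mult.assoc)
  have "u 0 = (\<Sum>x\<in>set_pmf p. pmf p x) * (\<Sum>y\<in>set_pmf p. pmf p y)"
    by (simp add: u_def sum_product)
  then have u0: "u 0 = 1"
    using fin by (simp add: sum_pmf_eq_1)
  show thesis
  proof (rule that[of q])
    show "q n k \<ge> 0" for n k
      using a u by (simp add: q_def)
    show "q 0 0 = 1"
      using a u0 by (simp add: q_def)
    fix r :: real
    assume r: "0 \<le> r" "r < 1"
    have "(\<lambda>n. pmf p x * pmf p y * (a (int n) * r ^ (2 * n) * Re (herm x y ^ n) +
              a (- int (Suc n)) * r ^ (2 * Suc n) * Re (herm x y ^ Suc n)))
        sums (pmf p x * pmf p y * Re (K (r *\<^sub>R x) (r *\<^sub>R y)))"
      if "x \<in> set_pmf p" "y \<in> set_pmf p" for x y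
    proof (rule sums_mult)
      define h where "h = herm (r *\<^sub>R x) (r *\<^sub>R y)"
      have h: "h = of_real (r\<^sup>2) * herm x y"
        by (simp add: h_def herm_scaleR power2_eq_square)
      have xy: "r *\<^sub>R x \<in> ball 0 1" "r *\<^sub>R y \<in> ball 0 1"
        using that p r by (auto intro!: scaleR_in_ball simp del: mem_ball mem_ball_0)
      then have "norm (r *\<^sub>R x) * norm (r *\<^sub>R y) < 1"
        using mult_strict_mono[of "norm (r *\<^sub>R x)" 1 "norm (r *\<^sub>R y)" 1] by simp
      then have "cmod h < 1"
        using cmod_herm_le[of "r *\<^sub>R x" "r *\<^sub>R y"] by (simp add: h_def)
      then have "(\<lambda>n. of_real (a (int n)) * h ^ n + of_real (a (- int (Suc n))) * cnj h ^ Suc n)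
          sums K (r *\<^sub>R x) (r *\<^sub>R y)"
        unfolding K[OF xy] h_def[symmetric]
        by (intro sums_add summable_sums s1 s2) simp_all
      then have "(\<lambda>n. Re (of_real (a (int n)) * h ^ n + of_real (a (- int (Suc n))) * cnj h ^ Suc n))
          sums Re (K (r *\<^sub>R x) (r *\<^sub>R y))"
        by (rule sums_Re)
      moreover have "Re (of_real (a (int n)) * h ^ n + of_real (a (- int (Suc n))) * cnj h ^ Suc n) =
          a (int n) * r ^ (2 * n) * Re (herm x y ^ n) +
          a (- int (Suc n)) * r ^ (2 * Suc n) * Re (herm x y ^ Suc n)" for n
      proof -
        have Re_h: "Re (h ^ m) = r ^ (2 * m) * Re (herm x y ^ m)" for m
          by (simp add: h power_mult_distrib power_mult flip: of_real_power)
        have "Re (cnj h ^ Suc n) = Re (h ^ Suc n)"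
          by (metis complex_cnj_power cnj.sel(1))
        then show ?thesis
          by (simp add: Re_h del: power_Suc)
      qed
      ultimately show "(\<lambda>n. a (int n) * r ^ (2 * n) * Re (herm x y ^ n) +
          a (- int (Suc n)) * r ^ (2 * Suc n) * Re (herm x y ^ Suc n)) sums Re (K (r *\<^sub>R x) (r *\<^sub>R y))"
        by simp
    qed
    then have "(\<lambda>n. \<Sum>x\<in>set_pmf p. \<Sum>y\<in>set_pmf p.
          pmf p x * pmf p y * (a (int n) * r ^ (2 * n) * Re (herm x y ^ n) +
              a (- int (Suc n)) * r ^ (2 * Suc n) * Re (herm x y ^ Suc n))) sums discrete_energy r p"
      unfolding discrete_energy_def by (intro sums_sum)
    then show "(\<lambda>n. q n 0 * r ^ (2 * n) + q n 1 * r ^ (2 * Suc n)) sums discrete_energy r p"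
      by (simp add: q_def u_def sum.distrib sum_distrib_left sum_distrib_right algebra_simps
          del: power_Suc)
  qed
qed

lemma discrete_energy_mono:
  assumes "finite (set_pmf p)" "set_pmf p \<subseteq> cball 0 1" "0 \<le> r" "r \<le> s" "s < 1"
  shows "discrete_energy r p \<le> discrete_energy s p"
proof -
  obtain q :: "nat \<Rightarrow> nat \<Rightarrow> real" where q: "\<And>n k. q n k \<ge> 0" and "q 0 0 = 1"
    and qs: "\<And>r. 0 \<le> r \<Longrightarrow> r < 1 \<Longrightarrow>
      (\<lambda>n. q n 0 * r ^ (2 * n) + q n 1 * r ^ (2 * Suc n)) sums discrete_energy r p"
    by (rule discrete_energy_sums[OF assms(1,2)], rule that)
  show ?thesis
    using assms q
    by (intro sums_le[OF _ qs qs] add_mono mult_left_mono power_mono) auto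
qed

text \<open>The constant term of the energy series is 1 and the other terms are nonnegative. The
  bound keeps the minimal energy away from 0, so that it can be divided by.\<close>

lemma discrete_energy_ge_1:
  assumes "finite (set_pmf p)" "set_pmf p \<subseteq> cball 0 1" "0 \<le> r" "r < 1"
  shows "1 \<le> discrete_energy r p"
proof -
  obtain q :: "nat \<Rightarrow> nat \<Rightarrow> real" where q: "\<And>n k. q n k \<ge> 0" "q 0 0 = 1"
    "\<And>r. 0 \<le> r \<Longrightarrow> r < 1 \<Longrightarrow>
      (\<lambda>n. q n 0 * r ^ (2 * n) + q n 1 * r ^ (2 * Suc n)) sums discrete_energy r p"
    by (rule discrete_energy_sums[OF assms(1,2)], rule that)
  have "(\<lambda>n. if n = 0 then 1 else 0 :: real) sums 1"
    using sums_single[of 0 "\<lambda>_. 1 :: real"] by simp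
  then show ?thesis
    using assms q(1,2) by (intro sums_le[OF _ _ q(3)]) auto
qed

text \<open>Turns energies into squared norms in \<open>H\<close>, so that quadratic expansion and
  Cauchy-Schwarz apply to them.\<close>

lemma norm_sq_dilated_kernel_sum:
  assumes "finite (set_pmf p)" "set_pmf p \<subseteq> cball 0 1" "0 \<le> r" "r < 1"
  shows "Re (ip (kernel_sum (set_pmf p) (pmf p) (\<lambda>x. r *\<^sub>R x))
               (kernel_sum (set_pmf p) (pmf p) (\<lambda>x. r *\<^sub>R x))) = discrete_energy r p"
  unfolding discrete_energy_def using assms
  by (intro norm_sq_kernel_sum) (auto intro!: scaleR_in_ball simp del: mem_ball mem_ball_0)

end

section \<open>The two inequalities\<close>

lemma prob_measures_onD:
  assumes "\<mu> \<in> prob_measures_on F"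
  shows "prob_space \<mu>" "sets \<mu> = sets (restrict_space borel (sphere 0 1))"
    "space \<mu> = sphere 0 1" "closed F \<Longrightarrow> AE z in \<mu>. z \<in> F"
proof -
  show 1: "prob_space \<mu>" and 2: "sets \<mu> = sets (restrict_space borel (sphere 0 1))"
    using assms by (auto simp: prob_measures_on_def)
  show 3: "space \<mu> = sphere 0 1"
    using sets_eq_imp_space_eq[OF 2] by (simp add: space_restrict_space)
  show "AE z in \<mu>. z \<in> F" if "closed F"
  proof (rule AE_I[of _ _ "sphere 0 1 - F"])
    have "sphere 0 1 - F \<in> sets borel"
      using that by (intro sets.Diff) auto
    then show "sphere 0 1 - F \<in> sets \<mu>"
      unfolding 2 by (subst sets_restrict_space_iff) auto
    show "emeasure \<mu> (sphere 0 1 - F) = 0"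
      using assms by (simp add: prob_measures_on_def)
  qed (auto simp: 3)
qed

lemma borel_measurable_continuous_on_sphere:
  fixes g :: "complex ^ 'n \<Rightarrow> complex"
  assumes "\<mu> \<in> prob_measures_on F" "continuous_on (cball 0 1) g"
  shows "g \<in> borel_measurable \<mu>"
  using borel_measurable_continuous_on_restrict[OF continuous_on_subset[OF assms(2) sphere_cball]]
    measurable_cong_sets[OF prob_measures_onD(2)[OF assms(1)] refl] by blast

context unitarily_invariant_pluriharmonic_space
begin

section \<open>Dilated kernels on the closed ball\<close>

lemma continuous_on_kernel_scaleR:
  assumes "0 \<le> r" "r < 1"
  shows "continuous_on (cball 0 1 \<times> cball 0 1) (\<lambda>(z, w). K (r *\<^sub>R z) (r *\<^sub>R w))"
proof -
  have "continuous_on (cball 0 1 \<times> cball 0 1)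
      (\<lambda>x. (\<lambda>(z, w). K z w) (r *\<^sub>R fst x, r *\<^sub>R snd x))"
    using assms
    by (intro continuous_on_compose2[OF continuous_on_kernel] continuous_intros)
       (auto intro!: scaleR_in_ball simp del: mem_ball mem_ball_0)
  then show ?thesis
    by (simp add: case_prod_unfold)
qed

lemma continuous_on_kernel_left:
  assumes "0 \<le> r" "r < 1" "w \<in> cball 0 1"
  shows "continuous_on (cball 0 1) (\<lambda>z. K (r *\<^sub>R z) (r *\<^sub>R w))"
proof -
  have "continuous_on (cball 0 1) (\<lambda>z. (\<lambda>(z, w). K (r *\<^sub>R z) (r *\<^sub>R w)) (z, w))"
    using assms
    by (intro continuous_on_compose2[OF continuous_on_kernel_scaleR] continuous_intros) auto
  then show ?thesis
    by simp
qed

lemma continuous_on_kernel_right: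
  assumes "0 \<le> r" "r < 1" "z \<in> cball 0 1"
  shows "continuous_on (cball 0 1) (\<lambda>w. K (r *\<^sub>R z) (r *\<^sub>R w))"
proof -
  have "continuous_on (cball 0 1) (\<lambda>w. (\<lambda>(z, w). K (r *\<^sub>R z) (r *\<^sub>R w)) (z, w))"
    using assms
    by (intro continuous_on_compose2[OF continuous_on_kernel_scaleR] continuous_intros) auto
  then show ?thesis
    by simp
qed

lemma kernel_scaleR_bounded:
  assumes "0 \<le> r" "r < 1"
  obtains D where "\<And>z w. z \<in> cball 0 1 \<Longrightarrow> w \<in> cball 0 1 \<Longrightarrow> cmod (K (r *\<^sub>R z) (r *\<^sub>R w)) \<le> D"
proof -
  have "bounded ((\<lambda>(z, w). K (r *\<^sub>R z) (r *\<^sub>R w)) ` (cball 0 1 \<times> cball 0 1))"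
    by (intro compact_imp_bounded compact_continuous_image compact_Times compact_cball
        continuous_on_kernel_scaleR assms)
  then show thesis
    using that unfolding bounded_iff by (auto simp del: mem_cball mem_cball_0)
qed

text \<open>Dilation by \<open>r\<close> sends the sphere into \<open>cball 0 r\<close>, a compact
  convex subset of the ball, as required by \<open>kernel_cauchy_schwarz_integral\<close>.\<close>

lemma integral_cauchy_schwarz:
  assumes \<mu>: "\<mu> \<in> prob_measures_on F" and r: "0 \<le> r" "r < 1"
    and f: "f \<in> H" "continuous_on (ball 0 1) f"
  shows "(cmod (\<integral>z. f (r *\<^sub>R z) \<partial>\<mu>))\<^sup>2 \<le>
    (ip_norm ip f)\<^sup>2 * Re (\<integral>z. (\<integral>w. K (r *\<^sub>R z) (r *\<^sub>R w) \<partial>\<mu>) \<partial>\<mu>)"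
proof (rule kernel_cauchy_schwarz_integral[OF rkhs_axioms prob_measures_onD(1)[OF \<mu>], of _ "cball 0 r"])
  have "(\<lambda>z :: complex ^ 'n. r *\<^sub>R z) \<in> borel_measurable (restrict_space borel (sphere 0 1))"
    by (intro measurable_restrict_space1 borel_measurable_continuous_onI continuous_intros)
  then show "(\<lambda>z. r *\<^sub>R z) \<in> borel_measurable \<mu>"
    using measurable_cong_sets[OF prob_measures_onD(2)[OF \<mu>] refl] by blast
qed (use r f continuous_on_kernel prob_measures_onD(3)[OF \<mu>] in auto)

section \<open>Upper bound for the capacity\<close>

lemma dual_le:
  assumes "closed F" and \<mu>: "\<mu> \<in> prob_measures_on F"
    and f: "f \<in> H" and g: "continuous_extension f g" "\<And>z. z \<in> F \<Longrightarrow> Re (g z) \<ge> 1"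
  shows "1 / energy K \<mu> \<le> ennreal ((ip_norm ip f)\<^sup>2)"
proof (cases "energy K \<mu>")
  \<comment> \<open>In the remaining case of infinite energy the left side is 0, which the closing
    \<open>simp\<close> settles.\<close>
  case (real e)
  interpret prob_space \<mu> by (rule prob_measures_onD(1)[OF \<mu>])
  have g_cont: "continuous_on (cball 0 1) g" and fg: "\<And>z. z \<in> ball 0 1 \<Longrightarrow> g z = f z"
    using g(1) by (auto simp: continuous_extension_def)
  have f_cont: "continuous_on (ball 0 1) f"
    using continuous_on_subset[OF g_cont ball_subset_cball] fg by (rule continuous_on_eq)
  obtain B where B: "\<And>z. z \<in> cball 0 1 \<Longrightarrow> cmod (g z) \<le> B"
    using compact_imp_bounded[OF compact_continuous_image[OF g_cont compact_cball]]
    unfolding bounded_iff by (auto simp del: mem_cball mem_cball_0)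
  define s where "s n = real n / real (Suc n)" for n
  have s: "0 \<le> s n" "s n < 1" for n
    by (auto simp: s_def)
  have s_lim: "s \<longlonglongrightarrow> 1"
    unfolding s_def by (rule LIMSEQ_n_over_Suc_n)
  have space: "z \<in> cball 0 1" if "z \<in> space \<mu>" for z
    using that by (simp add: prob_measures_onD(3)[OF \<mu>])
  have sg_cont: "continuous_on (cball 0 1) (\<lambda>z. g (s n *\<^sub>R z))" for n
    using s[of n]
    by (intro continuous_on_compose2[OF g_cont] continuous_intros) (auto intro!: mult_le_one)
  \<comment> \<open>Functions in \<open>H\<close> vanish off the open ball, so the boundary is
    reached through \<open>g\<close> along the radii \<open>s n\<close> increasing to 1.\<close>
  have lim: "(\<lambda>n. \<integral>z. g (s n *\<^sub>R z) \<partial>\<mu>) \<longlonglongrightarrow> (\<integral>z. g z \<partial>\<mu>)"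
  proof (rule integral_dominated_convergence[where w = "\<lambda>_. B"])
    have "(\<lambda>n. g (s n *\<^sub>R z)) \<longlonglongrightarrow> g z" if "z \<in> space \<mu>" for z
    proof (rule continuous_on_tendsto_compose[OF g_cont])
      show "(\<lambda>n. s n *\<^sub>R z) \<longlonglongrightarrow> z"
        using tendsto_scaleR[OF s_lim tendsto_const, of z] by simp
      show "\<forall>\<^sub>F n in sequentially. s n *\<^sub>R z \<in> cball 0 1"
        using s(1) less_imp_le[OF s(2)] space[OF that]
        by (intro always_eventually) (auto intro!: mult_le_one)
    qed (rule space[OF that])
    then show "AE z in \<mu>. (\<lambda>n. g (s n *\<^sub>R z)) \<longlonglongrightarrow> g z"
      by (rule AE_I2)
    show "AE z in \<mu>. norm (g (s n *\<^sub>R z)) \<le> B" for n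
      using s[of n] space by (intro AE_I2 B) (auto intro!: mult_le_one)
  qed (auto intro!: borel_measurable_continuous_on_sphere[OF \<mu>] g_cont sg_cont)
  have "(cmod (\<integral>z. g (s n *\<^sub>R z) \<partial>\<mu>))\<^sup>2 \<le> (ip_norm ip f)\<^sup>2 * e" for n
  proof -
    define E where "E = Re (\<integral>z. (\<integral>w. K (s n *\<^sub>R z) (s n *\<^sub>R w) \<partial>\<mu>) \<partial>\<mu>)"
    have "ennreal E \<le> energy K \<mu>"
      unfolding E_def energy_def using s[of n] by (intro SUP_upper) auto
    then have "E \<le> e"
      using real by (simp add: ennreal_le_iff)
    have "(\<integral>z. g (s n *\<^sub>R z) \<partial>\<mu>) = (\<integral>z. f (s n *\<^sub>R z) \<partial>\<mu>)"
      using s[of n] space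
      by (intro Bochner_Integration.integral_cong refl fg scaleR_in_ball) auto
    then have "(cmod (\<integral>z. g (s n *\<^sub>R z) \<partial>\<mu>))\<^sup>2 \<le> (ip_norm ip f)\<^sup>2 * E"
      using integral_cauchy_schwarz[OF \<mu> s f f_cont, of n] by (simp add: E_def)
    also have "\<dots> \<le> (ip_norm ip f)\<^sup>2 * e"
      using \<open>E \<le> e\<close> by (intro mult_left_mono) auto
    finally show ?thesis .
  qed
  then have le: "(cmod (\<integral>z. g z \<partial>\<mu>))\<^sup>2 \<le> (ip_norm ip f)\<^sup>2 * e"
    by (intro LIMSEQ_le_const2[OF tendsto_power[OF tendsto_norm[OF lim]]]) auto
  have g_int: "integrable \<mu> g"
    using B space
    by (intro integrable_const_bound[where B = B] borel_measurable_continuous_on_sphere[OF \<mu>] g_cont)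
       auto
  \<comment> \<open>\<open>\<mu>\<close> lives on \<open>F\<close>, where \<open>Re (g z)\<close> is
    at least 1, so the mean is at least 1. In particular \<open>e\<close> cannot be 0.\<close>
  have "1 \<le> (\<integral>z. Re (g z) \<partial>\<mu>)"
    using prob_measures_onD(4)[OF \<mu> \<open>closed F\<close>] g(2) g_int by (intro integral_ge_const) auto
  also have "\<dots> = Re (\<integral>z. g z \<partial>\<mu>)"
    using g_int by (rule integral_Re)
  also have "\<dots> \<le> cmod (\<integral>z. g z \<partial>\<mu>)"
    by (rule complex_Re_le_cmod)
  finally have "1 \<le> (cmod (\<integral>z. g z \<partial>\<mu>))\<^sup>2"
    by (rule one_le_power)
  with le have "1 \<le> (ip_norm ip f)\<^sup>2 * e"
    by linarith
  then have "e > 0"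
    using real(1) by (cases "e = 0") auto
  then have "1 / e \<le> (ip_norm ip f)\<^sup>2"
    using \<open>1 \<le> (ip_norm ip f)\<^sup>2 * e\<close> by (simp add: pos_divide_le_eq)
  then have "ennreal (1 / e) \<le> ennreal ((ip_norm ip f)\<^sup>2)"
    by (rule ennreal_leI)
  then show ?thesis
    using \<open>e > 0\<close> real by (simp add: divide_ennreal flip: ennreal_1)
qed simp

section \<open>Discrete near-minimisers and their potentials\<close>

lemma kernel_sum_pmf_extend:
  assumes "finite S" "set_pmf p \<subseteq> S"
  shows "kernel_sum (set_pmf p) (pmf p) g = kernel_sum S (pmf p) g"
  unfolding kernel_sum_def using assms
  by (intro ext sum.mono_neutral_left) (auto simp: set_pmf_iff)

text \<open>The measure \<open>q\<close> is \<open>(1 - t) p\<close> plus the mass \<open>t\<close>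
  at \<open>w\<close>. Its potential is the same combination of the potential of \<open>p\<close>
  and a kernel function, and the formula expands the squared norm.\<close>

lemma discrete_energy_mixture:
  assumes p: "finite (set_pmf p)" "set_pmf p \<subseteq> cball 0 1" and w: "w \<in> cball 0 1"
    and r: "0 \<le> r" "r < 1" and t: "0 \<le> t" "t \<le> 1"
  obtains q where "set_pmf q \<subseteq> insert w (set_pmf p)"
    "discrete_energy r q = (1 - t)\<^sup>2 * discrete_energy r p
      + 2 * t * (1 - t) * Re (\<Sum>x\<in>set_pmf p. of_real (pmf p x) * K (r *\<^sub>R w) (r *\<^sub>R x))
      + t\<^sup>2 * Re (K (r *\<^sub>R w) (r *\<^sub>R w))"
proof
  define q where "q = bind_pmf (bernoulli_pmf t) (\<lambda>b. if b then return_pmf w else p)"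
  \<comment> \<open>Both supports lie in this finite set and masses vanish off the supports, so all
    sums can be taken over it.\<close>
  define S where "S = insert w (set_pmf p)"
  show q_sub: "set_pmf q \<subseteq> insert w (set_pmf p)"
    by (auto simp: q_def split: if_splits)
  have S: "finite S" "set_pmf p \<subseteq> S" "set_pmf q \<subseteq> S" "w \<in> S" "S \<subseteq> cball 0 1"
    using p w q_sub by (auto simp: S_def)
  have pmf_q: "pmf q x = (1 - t) * pmf p x + t * indicator {w} x" for x
    using t by (simp add: q_def pmf_bind integral_bernoulli_pmf indicator_def)
  define h where "h = kernel_sum (set_pmf p) (pmf p) (\<lambda>x. r *\<^sub>R x)"
  define k where "k = kernel_at (r *\<^sub>R w)"
  have rw: "r *\<^sub>R w \<in> ball 0 1"
    using w r by (intro scaleR_in_ball) auto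
  have h: "h \<in> H"
    unfolding h_def using p r by (intro kernel_sum_mem) (auto intro!: scaleR_in_ball simp del: mem_ball mem_ball_0)
  have k: "k \<in> H"
    unfolding k_def using rw by (rule kernel_at_mem)
  have "kernel_sum (set_pmf q) (pmf q) (\<lambda>x. r *\<^sub>R x) = kernel_sum S (pmf q) (\<lambda>x. r *\<^sub>R x)"
    using S by (intro kernel_sum_pmf_extend)
  also have "\<dots> = (\<lambda>z. of_real (1 - t) * h z + of_real t * k z)"
  proof
    fix z
    have "kernel_sum S (pmf q) (\<lambda>x. r *\<^sub>R x) z =
        (\<Sum>x\<in>S. of_real (1 - t) * (of_real (pmf p x) * kernel_at (r *\<^sub>R x) z) +
          (if x = w then of_real t * kernel_at (r *\<^sub>R w) z else 0))"
      unfolding kernel_sum_def by (intro sum.cong) (auto simp: pmf_q algebra_simps)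
    also have "\<dots> = of_real (1 - t) * kernel_sum S (pmf p) (\<lambda>x. r *\<^sub>R x) z + of_real t * k z"
      using S by (simp add: sum.distrib sum_distrib_left kernel_sum_def k_def)
    also have "kernel_sum S (pmf p) (\<lambda>x. r *\<^sub>R x) = h"
      unfolding h_def using S by (intro kernel_sum_pmf_extend[symmetric])
    finally show "kernel_sum S (pmf q) (\<lambda>x. r *\<^sub>R x) z = of_real (1 - t) * h z + of_real t * k z" .
  qed
  finally have q_sum: "kernel_sum (set_pmf q) (pmf q) (\<lambda>x. r *\<^sub>R x) =
      (\<lambda>z. of_real (1 - t) * h z + of_real t * k z)" .
  have norm: "Re (ip (\<lambda>z. of_real s * h z + of_real t * k z) (\<lambda>z. of_real s * h z + of_real t * k z)) =
      s\<^sup>2 * Re (ip h h) + 2 * t * s * Re (ip h k) + t\<^sup>2 * Re (ip k k)" for s :: real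
    using norm_sq_add[OF scale_mem[OF h, of "of_real s"] k, of "of_real t"] h k
    by (simp add: ip_scale_left ip_scale_right scale_mem power2_eq_square)
  have "discrete_energy r q = Re (ip (\<lambda>z. of_real (1 - t) * h z + of_real t * k z)
      (\<lambda>z. of_real (1 - t) * h z + of_real t * k z))"
    unfolding q_sum[symmetric] using S r finite_subset[of "set_pmf q" S]
    by (intro norm_sq_dilated_kernel_sum[symmetric]) auto
  also have "\<dots> = (1 - t)\<^sup>2 * Re (ip h h) + 2 * t * (1 - t) * Re (ip h k) + t\<^sup>2 * Re (ip k k)"
    by (rule norm)
  also have "Re (ip h h) = discrete_energy r p"
    unfolding h_def using p r by (intro norm_sq_dilated_kernel_sum)
  also have "ip h k = h (r *\<^sub>R w)"
    unfolding k_def kernel_at_def using h rw by (rule reproducing)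
  also have "h (r *\<^sub>R w) = (\<Sum>x\<in>set_pmf p. of_real (pmf p x) * K (r *\<^sub>R w) (r *\<^sub>R x))"
    unfolding h_def using rw by (rule kernel_sum_eq)
  also have "ip k k = K (r *\<^sub>R w) (r *\<^sub>R w)"
    using reproducing[OF k rw] rw by (simp add: k_def kernel_at_def)
  finally show "discrete_energy r q = (1 - t)\<^sup>2 * discrete_energy r p
      + 2 * t * (1 - t) * Re (\<Sum>x\<in>set_pmf p. of_real (pmf p x) * K (r *\<^sub>R w) (r *\<^sub>R x))
      + t\<^sup>2 * Re (K (r *\<^sub>R w) (r *\<^sub>R w))" .
qed

text \<open>Dividing the potential by its lower bound \<open>L\<close> on \<open>F\<close> makes it
  admissible.\<close>

lemma admissible_potential:
  assumes p: "finite (set_pmf p)" "set_pmf p \<subseteq> cball 0 1" and r: "0 \<le> r" "r < 1" and "L > 0"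
    and F: "F \<subseteq> cball 0 1"
    and L: "\<And>w. w \<in> F \<Longrightarrow> L \<le> Re (\<Sum>x\<in>set_pmf p. of_real (pmf p x) * K (r *\<^sub>R w) (r *\<^sub>R x))"
  obtains f g where "f \<in> H" "continuous_extension f g" "\<And>z. z \<in> F \<Longrightarrow> Re (g z) \<ge> 1"
    "(ip_norm ip f)\<^sup>2 \<le> discrete_energy r p / L\<^sup>2"
proof
  \<comment> \<open>Kernel functions at the points \<open>r^2 x\<close> place \<open>f\<close> in
    \<open>H\<close>; dilating both variables makes \<open>g\<close> continuous up to the boundary.
    By \<open>kernel_scaleR\<close> the two agree on the open ball.\<close>
  define f where "f = kernel_sum (set_pmf p) (\<lambda>x. pmf p x / L) (\<lambda>x. r\<^sup>2 *\<^sub>R x)"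
  define g where "g z = (\<Sum>x\<in>set_pmf p. of_real (pmf p x) * K (r *\<^sub>R z) (r *\<^sub>R x)) / of_real L" for z
  have r2: "0 \<le> r\<^sup>2" "r\<^sup>2 \<le> r" "r\<^sup>2 < 1"
    using r by (auto simp: power2_eq_square mult_left_le_one_le intro: order_le_less_trans[of _ r])
  have ball: "(\<lambda>x. r\<^sup>2 *\<^sub>R x) ` set_pmf p \<subseteq> ball 0 1"
    using p r2 by (auto intro!: scaleR_in_ball simp del: mem_ball mem_ball_0)
  show f: "f \<in> H"
    unfolding f_def using p ball by (intro kernel_sum_mem)
  have "continuous_on (cball 0 1) g"
    unfolding g_def using p r \<open>L > 0\<close>
    by (intro continuous_intros continuous_on_kernel_left) auto
  moreover have "g z = f z" if "z \<in> ball 0 1" for z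
  proof -
    have "K (r *\<^sub>R z) (r *\<^sub>R x) = K z (r\<^sup>2 *\<^sub>R x)" if "x \<in> set_pmf p" for x
      using p r \<open>z \<in> ball 0 1\<close> that by (intro kernel_scaleR) auto
    then show ?thesis
      using that by (simp add: g_def f_def kernel_sum_eq sum_divide_distrib)
  qed
  ultimately show "continuous_extension f g"
    by (simp add: continuous_extension_def)
  show "Re (g z) \<ge> 1" if "z \<in> F" for z
    using L[OF that] \<open>L > 0\<close> by (simp add: g_def)
  \<comment> \<open>The squared norm is an energy at the radius \<open>r^2 <= r\<close>, so
    monotonicity in the radius applies.\<close>
  have "(ip_norm ip f)\<^sup>2 = discrete_energy (r\<^sup>2) p / L\<^sup>2"
    unfolding ip_norm_sq[OF f] unfolding f_def norm_sq_kernel_sum[OF p(1) ball] discrete_energy_def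
    by (simp add: sum_divide_distrib power2_eq_square)
  also have "\<dots> \<le> discrete_energy r p / L\<^sup>2"
    using p r r2 by (intro divide_right_mono discrete_energy_mono) auto
  finally show "(ip_norm ip f)\<^sup>2 \<le> discrete_energy r p / L\<^sup>2" .
qed

text \<open>
  If \<open>p\<close> nearly minimises the energy, moving the mass \<open>t\<close> to a point \<open>w\<close> cannot decrease the energy
  by more than \<open>t\<^sup>2\<close>; to first order in \<open>t\<close> this says that the real part of the potential of \<open>p\<close>
  at \<open>w\<close> is at least the infimum \<open>c\<close> of the energy.
\<close>

lemma exists_discrete_energy_less:
  assumes F: "F \<noteq> {}" "F \<subseteq> cball 0 1" and r: "0 \<le> r" "r < 1" and "I > 0" "\<epsilon> > 0"
    and I: "\<And>f. f \<in> H \<Longrightarrow> \<exists>g. continuous_extension f g \<and> (\<forall>z\<in>F. Re (g z) \<ge> 1) \<Longrightarrow>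
      I \<le> (ip_norm ip f)\<^sup>2"
  obtains p where "finite (set_pmf p)" "set_pmf p \<subseteq> F" "discrete_energy r p < 1 / I + \<epsilon>"
proof -
  define P where "P = {p. finite (set_pmf p) \<and> set_pmf p \<subseteq> F}"
  define c where "c = (INF p\<in>P. discrete_energy r p)"
  obtain w0 where "w0 \<in> F"
    using F by blast
  then have "return_pmf w0 \<in> P"
    by (simp add: P_def)
  then have "P \<noteq> {}"
    by blast
  have ge_1: "1 \<le> discrete_energy r p" if "p \<in> P" for p
    using that F r by (intro discrete_energy_ge_1) (auto simp: P_def)
  have bdd: "bdd_below (discrete_energy r ` P)"
    using ge_1 by (auto simp: bdd_below_def)
  have c_le: "c \<le> discrete_energy r p" if "p \<in> P" for p
    unfolding c_def using bdd that by (rule cINF_lower)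
  have "1 \<le> c"
    unfolding c_def using \<open>P \<noteq> {}\<close> ge_1 by (rule cINF_greatest)
  obtain B where B: "\<And>z w. z \<in> cball 0 1 \<Longrightarrow> w \<in> cball 0 1 \<Longrightarrow> cmod (K (r *\<^sub>R z) (r *\<^sub>R w)) \<le> B"
    using kernel_scaleR_bounded[OF r] by blast
  have "B \<ge> 0"
    using B[of 0 0] norm_ge_zero[of "K (r *\<^sub>R 0) (r *\<^sub>R 0)"] by (simp del: norm_ge_zero)
  \<comment> \<open>Dominates the second-order terms in \<open>t\<close>, namely 1 from
    near-minimality and \<open>B\<close> from the self-energy at \<open>w\<close>: the contradiction
    below comes from \<open>1 + B < c + D\<close>.\<close>
  define D where "D = 1 + B + c"
  have bound: "I \<le> (c + t\<^sup>2) / (c - t * D)\<^sup>2" if t: "0 < t" "t \<le> 1/2" and L: "0 < c - t * D" for t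
  proof -
    have "(INF p\<in>P. discrete_energy r p) < c + t\<^sup>2"
      using t by (simp add: c_def[symmetric])
    then obtain p where p: "p \<in> P" "discrete_energy r p < c + t\<^sup>2"
      using cINF_less_iff[OF \<open>P \<noteq> {}\<close> bdd] by blast
    have p': "finite (set_pmf p)" "set_pmf p \<subseteq> cball 0 1"
      using p F by (auto simp: P_def)
    have "c - t * D \<le> Re (\<Sum>x\<in>set_pmf p. of_real (pmf p x) * K (r *\<^sub>R w) (r *\<^sub>R x))" (is "_ \<le> ?R")
      if "w \<in> F" for w
    proof (rule ccontr)
      assume "\<not> c - t * D \<le> ?R"
      then have less: "2 * t * (1 - t) * ?R \<le> 2 * t * (1 - t) * (c - t * D)"
        using t by (intro mult_left_mono) auto
      have w: "w \<in> cball 0 1"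
        using that F by blast
      obtain q where q: "set_pmf q \<subseteq> insert w (set_pmf p)"
        "discrete_energy r q = (1 - t)\<^sup>2 * discrete_energy r p + 2 * t * (1 - t) * ?R
          + t\<^sup>2 * Re (K (r *\<^sub>R w) (r *\<^sub>R w))"
        using discrete_energy_mixture[OF p' w r, of t] t by auto
      have "q \<in> P"
        using q(1) p that by (auto simp: P_def intro: finite_subset)
      then have "c \<le> discrete_energy r q"
        by (rule c_le)
      moreover have "(1 - t)\<^sup>2 * discrete_energy r p \<le> (1 - t)\<^sup>2 * c + t\<^sup>2"
      proof -
        have "(1 - t)\<^sup>2 * discrete_energy r p \<le> (1 - t)\<^sup>2 * (c + t\<^sup>2)"
          using p(2) by (intro mult_left_mono) auto
        moreover have "(1 - t)\<^sup>2 * t\<^sup>2 \<le> 1 * t\<^sup>2"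
          using t by (intro mult_right_mono power_le_one) auto
        ultimately show ?thesis
          by (simp add: distrib_left)
      qed
      moreover have "t\<^sup>2 * Re (K (r *\<^sub>R w) (r *\<^sub>R w)) \<le> t\<^sup>2 * B"
        using B[OF w w] complex_Re_le_cmod[of "K (r *\<^sub>R w) (r *\<^sub>R w)"]
        by (intro mult_left_mono) auto
      ultimately have "c \<le> (1 - t)\<^sup>2 * c + t\<^sup>2 + 2 * t * (1 - t) * (c - t * D) + t\<^sup>2 * B"
        using q(2) less by linarith
      \<comment> \<open>Since \<open>(1 - t)^2 + 2 t (1 - t) = 1 - t^2\<close>, the lower-order
        terms cancel and \<open>t^2\<close> can be divided out.\<close>
      then have "t\<^sup>2 * (c + 2 * (1 - t) * D) \<le> t\<^sup>2 * (1 + B)"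
        by (simp add: power2_eq_square algebra_simps)
      then have "c + 2 * (1 - t) * D \<le> 1 + B"
        using t by simp
      moreover have "1 * D \<le> (2 * (1 - t)) * D"
        using t \<open>B \<ge> 0\<close> \<open>1 \<le> c\<close> by (intro mult_right_mono) (auto simp: D_def)
      ultimately show False
        using \<open>1 \<le> c\<close> by (simp add: D_def)
    qed
    then obtain f g where fg: "f \<in> H" "continuous_extension f g" "\<And>z. z \<in> F \<Longrightarrow> Re (g z) \<ge> 1"
      "(ip_norm ip f)\<^sup>2 \<le> discrete_energy r p / (c - t * D)\<^sup>2"
      using admissible_potential[OF p' r L F(2)] by blast
    have "I \<le> (ip_norm ip f)\<^sup>2"
      using fg(1-3) by (intro I) blast+
    also note fg(4)
    also have "discrete_energy r p / (c - t * D)\<^sup>2 \<le> (c + t\<^sup>2) / (c - t * D)\<^sup>2"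
      using p(2) by (intro divide_right_mono) auto
    finally show ?thesis .
  qed
  \<comment> \<open>As \<open>t\<close> tends to 0 from the right, the bound tends to
    \<open>c / c^2 = 1 / c\<close>.\<close>
  have "I \<le> (c + 0\<^sup>2) / (c - 0 * D)\<^sup>2"
  proof (rule tendsto_lowerbound)
    show "((\<lambda>t. (c + t\<^sup>2) / (c - t * D)\<^sup>2) \<longlongrightarrow> (c + 0\<^sup>2) / (c - 0 * D)\<^sup>2) (at_right 0)"
      using \<open>1 \<le> c\<close> by (intro tendsto_intros) auto
    have "((\<lambda>t. c - t * D) \<longlongrightarrow> c - 0 * D) (at_right 0)"
      by (intro tendsto_intros)
    then have "\<forall>\<^sub>F t in at_right 0. 0 < c - t * D"
      using \<open>1 \<le> c\<close> by (intro order_tendstoD) auto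
    moreover have "\<forall>\<^sub>F t in at_right (0 :: real). t \<in> {0<..<1/2}"
      by (intro eventually_at_right_real) auto
    ultimately show "\<forall>\<^sub>F t in at_right 0. I \<le> (c + t\<^sup>2) / (c - t * D)\<^sup>2"
      by eventually_elim (intro bound, auto)
  qed simp
  then have "I \<le> 1 / c"
    using \<open>1 \<le> c\<close> by (simp add: power2_eq_square)
  then have "c \<le> 1 / I"
    using \<open>I > 0\<close> \<open>1 \<le> c\<close> by (simp add: field_simps)
  then have "c < 1 / I + \<epsilon>"
    using \<open>\<epsilon> > 0\<close> by linarith
  then obtain p where "p \<in> P" "discrete_energy r p < 1 / I + \<epsilon>"
    using cINF_less_iff[OF \<open>P \<noteq> {}\<close> bdd] by (auto simp: c_def)
  then show thesis
    using that by (auto simp: P_def)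
qed

section \<open>Passage to a weak limit\<close>

lemma continuous_on_potential:
  assumes \<mu>: "\<mu> \<in> prob_measures_on F" and r: "0 \<le> r" "r < 1"
  shows "continuous_on (cball 0 1) (\<lambda>w. \<integral>z. K (r *\<^sub>R w) (r *\<^sub>R z) \<partial>\<mu>)"
proof (rule continuous_on_sequentiallyI)
  interpret prob_space \<mu> by (rule prob_measures_onD(1)[OF \<mu>])
  fix u :: "nat \<Rightarrow> complex ^ 'n" and a
  assume u: "\<forall>n. u n \<in> cball 0 1" "a \<in> cball 0 1" "u \<longlonglongrightarrow> a"
  obtain D where D: "\<And>z w. z \<in> cball 0 1 \<Longrightarrow> w \<in> cball 0 1 \<Longrightarrow> cmod (K (r *\<^sub>R z) (r *\<^sub>R w)) \<le> D"
    using kernel_scaleR_bounded[OF r] by blast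
  have space: "z \<in> cball 0 1" if "z \<in> space \<mu>" for z
    using that by (simp add: prob_measures_onD(3)[OF \<mu>])
  show "(\<lambda>n. \<integral>z. K (r *\<^sub>R u n) (r *\<^sub>R z) \<partial>\<mu>) \<longlonglongrightarrow> (\<integral>z. K (r *\<^sub>R a) (r *\<^sub>R z) \<partial>\<mu>)"
  proof (rule integral_dominated_convergence[where w = "\<lambda>_. D"])
    show "AE z in \<mu>. (\<lambda>n. K (r *\<^sub>R u n) (r *\<^sub>R z)) \<longlonglongrightarrow> K (r *\<^sub>R a) (r *\<^sub>R z)"
    proof (rule AE_I2)
      fix z assume z: "z \<in> space \<mu>"
      show "(\<lambda>n. K (r *\<^sub>R u n) (r *\<^sub>R z)) \<longlonglongrightarrow> K (r *\<^sub>R a) (r *\<^sub>R z)"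
        by (rule continuous_on_tendsto_compose[OF continuous_on_kernel_left[OF r space[OF z]] u(3,2)])
           (use u(1) in \<open>simp add: always_eventually\<close>)
    qed
    show "AE z in \<mu>. norm (K (r *\<^sub>R u n) (r *\<^sub>R z)) \<le> D" for n
      using u(1) space by (intro AE_I2 D) simp_all
    show "(\<lambda>z. K (r *\<^sub>R u n) (r *\<^sub>R z)) \<in> borel_measurable \<mu>" for n
      using u(1) by (intro borel_measurable_continuous_on_sphere[OF \<mu>] continuous_on_kernel_right[OF r]) simp
    show "(\<lambda>z. K (r *\<^sub>R a) (r *\<^sub>R z)) \<in> borel_measurable \<mu>"
      using u(2) by (intro borel_measurable_continuous_on_sphere[OF \<mu>] continuous_on_kernel_right[OF r])
  qed simp
qed

text \<open>The sum is the mixed energy of \<open>p\<close> and \<open>\<mu>\<close>. It equals the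
  real part of the integral over \<open>\<mu>\<close> of the dilated potential \<open>h\<close> of
  \<open>p\<close>, and the squared norm of \<open>h\<close> is the energy of \<open>p\<close>; so
  Cauchy-Schwarz for \<open>h\<close> suffices.\<close>

lemma discrete_potential_le:
  assumes \<mu>: "\<mu> \<in> prob_measures_on F" and r: "0 \<le> r" "r < 1"
    and p: "finite (set_pmf p)" "set_pmf p \<subseteq> cball 0 1"
  shows "(\<Sum>x\<in>set_pmf p. pmf p x * Re (\<integral>z. K (r *\<^sub>R x) (r *\<^sub>R z) \<partial>\<mu>))\<^sup>2 \<le>
    discrete_energy r p * Re (\<integral>z. (\<integral>w. K (r *\<^sub>R z) (r *\<^sub>R w) \<partial>\<mu>) \<partial>\<mu>)"
proof -
  interpret prob_space \<mu> by (rule prob_measures_onD(1)[OF \<mu>])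
  obtain D where D: "\<And>z w. z \<in> cball 0 1 \<Longrightarrow> w \<in> cball 0 1 \<Longrightarrow> cmod (K (r *\<^sub>R z) (r *\<^sub>R w)) \<le> D"
    using kernel_scaleR_bounded[OF r] by blast
  have space: "z \<in> cball 0 1" if "z \<in> space \<mu>" for z
    using that by (simp add: prob_measures_onD(3)[OF \<mu>])
  define h where "h = kernel_sum (set_pmf p) (pmf p) (\<lambda>x. r *\<^sub>R x)"
  have sub: "(\<lambda>x. r *\<^sub>R x) ` set_pmf p \<subseteq> ball 0 1"
    using p r by (auto intro!: scaleR_in_ball simp del: mem_ball mem_ball_0)
  have h: "h \<in> H"
    unfolding h_def using p sub by (intro kernel_sum_mem)
  have h_eq: "h z = (\<Sum>x\<in>set_pmf p. of_real (pmf p x) * K z (r *\<^sub>R x))" if "z \<in> ball 0 1" for z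
    unfolding h_def using that by (rule kernel_sum_eq)
  have "continuous_on (ball 0 1) (\<lambda>z. (\<lambda>(z, w). K z w) (z, r *\<^sub>R x))" if "x \<in> set_pmf p" for x
    using sub that by (intro continuous_on_compose2[OF continuous_on_kernel] continuous_intros) auto
  then have "continuous_on (ball 0 1) (\<lambda>z. \<Sum>x\<in>set_pmf p. of_real (pmf p x) * K z (r *\<^sub>R x))"
    by (intro continuous_intros) simp
  then have h_cont: "continuous_on (ball 0 1) h"
    by (rule continuous_on_eq) (simp add: h_eq)
  have int: "integrable \<mu> (\<lambda>z. K (r *\<^sub>R z) (r *\<^sub>R x))" if "x \<in> set_pmf p" for x
    using that p space r
    by (intro integrable_const_bound[where B = D] borel_measurable_continuous_on_sphere[OF \<mu>]
        continuous_on_kernel_left AE_I2 D) auto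
  have rz: "r *\<^sub>R z \<in> ball 0 1" if "z \<in> cball 0 1" for z :: "complex ^ 'n"
    using that r by (intro scaleR_in_ball) auto
  have "(\<integral>z. h (r *\<^sub>R z) \<partial>\<mu>) =
      (\<integral>z. (\<Sum>x\<in>set_pmf p. of_real (pmf p x) * K (r *\<^sub>R z) (r *\<^sub>R x)) \<partial>\<mu>)"
    using space rz by (intro Bochner_Integration.integral_cong refl h_eq) auto
  also have "\<dots> = (\<Sum>x\<in>set_pmf p. of_real (pmf p x) * (\<integral>z. K (r *\<^sub>R z) (r *\<^sub>R x) \<partial>\<mu>))"
    using int by (subst Bochner_Integration.integral_sum) auto
  \<comment> \<open>Hermitian symmetry exchanges the arguments at the cost of a conjugation, which
    real parts ignore.\<close>
  also have "\<dots> = (\<Sum>x\<in>set_pmf p. of_real (pmf p x) * cnj (\<integral>z. K (r *\<^sub>R x) (r *\<^sub>R z) \<partial>\<mu>))"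
  proof (rule sum.cong[OF refl])
    fix x assume "x \<in> set_pmf p"
    then have "(\<integral>z. K (r *\<^sub>R z) (r *\<^sub>R x) \<partial>\<mu>) = (\<integral>z. cnj (K (r *\<^sub>R x) (r *\<^sub>R z)) \<partial>\<mu>)"
      using p space rz by (intro Bochner_Integration.integral_cong refl kernel_cnj) auto
    then show "of_real (pmf p x) * (\<integral>z. K (r *\<^sub>R z) (r *\<^sub>R x) \<partial>\<mu>) =
        of_real (pmf p x) * cnj (\<integral>z. K (r *\<^sub>R x) (r *\<^sub>R z) \<partial>\<mu>)"
      by (simp add: integral_cnj)
  qed
  finally have "(\<Sum>x\<in>set_pmf p. pmf p x * Re (\<integral>z. K (r *\<^sub>R x) (r *\<^sub>R z) \<partial>\<mu>)) =
      Re (\<integral>z. h (r *\<^sub>R z) \<partial>\<mu>)"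
    by (simp add: Re_sum)
  then have "(\<Sum>x\<in>set_pmf p. pmf p x * Re (\<integral>z. K (r *\<^sub>R x) (r *\<^sub>R z) \<partial>\<mu>))\<^sup>2 \<le>
      (cmod (\<integral>z. h (r *\<^sub>R z) \<partial>\<mu>))\<^sup>2"
    by (metis abs_Re_le_cmod abs_ge_zero power2_abs power_mono)
  also have "\<dots> \<le> (ip_norm ip h)\<^sup>2 * Re (\<integral>z. (\<integral>w. K (r *\<^sub>R z) (r *\<^sub>R w) \<partial>\<mu>) \<partial>\<mu>)"
    by (rule integral_cauchy_schwarz[OF \<mu> r h h_cont])
  also have "(ip_norm ip h)\<^sup>2 = discrete_energy r p"
    unfolding ip_norm_sq[OF h] unfolding h_def by (rule norm_sq_dilated_kernel_sum[OF p r])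
  finally show ?thesis .
qed

text \<open>
  Lower semicontinuity of the energy under weak convergence: pairing the limit measure with the
  discrete measures only involves the continuous potential of the limit, and Cauchy-Schwarz
  bounds this mixed energy.
\<close>

lemma exists_measure_energy_le:
  assumes F: "compact F" "F \<subseteq> sphere 0 1" and "b \<ge> 0"
    and approx: "\<And>r \<epsilon>. 0 \<le> r \<Longrightarrow> r < 1 \<Longrightarrow> \<epsilon> > 0 \<Longrightarrow>
      \<exists>p. finite (set_pmf p) \<and> set_pmf p \<subseteq> F \<and> discrete_energy r p < b + \<epsilon>"
  obtains \<mu> where "\<mu> \<in> prob_measures_on F" "energy K \<mu> \<le> ennreal b"
proof -
  define s where "s n = real n / real (Suc n)" for n
  have s: "0 \<le> s n" "s n < 1" for n
    by (auto simp: s_def)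
  have s_lim: "s \<longlonglongrightarrow> 1"
    unfolding s_def by (rule LIMSEQ_n_over_Suc_n)
  have "\<exists>p. finite (set_pmf p) \<and> set_pmf p \<subseteq> F \<and> discrete_energy (s n) p < b + 1 / real (Suc n)" for n
    using s by (intro approx) auto
  then obtain p where fin: "\<And>n. finite (set_pmf (p n))" and p: "\<And>n. set_pmf (p n) \<subseteq> F"
    and p_less: "\<And>n. discrete_energy (s n) (p n) < b + 1 / real (Suc n)"
    by metis
  obtain \<nu> and \<sigma> :: "nat \<Rightarrow> nat" where \<nu>: "prob_space \<nu>" "sets \<nu> = sets borel" "emeasure \<nu> F = 1"
    and \<sigma>: "strict_mono \<sigma>"
    and lim: "\<And>h :: complex ^ 'n \<Rightarrow> real. continuous_on UNIV h \<Longrightarrow> bounded (range h) \<Longrightarrow>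
       (\<lambda>n. measure_pmf.expectation (p (\<sigma> n)) h) \<longlonglongrightarrow> integral\<^sup>L \<nu> h"
    by (rule pmf_compactness[OF F(1) p], rule that)
  interpret \<nu>: prob_space \<nu> by (rule \<nu>(1))
  have F_sets: "F \<in> sets \<nu>"
    using compact_imp_closed[OF F(1)] \<nu>(2) by simp
  have AE_F: "AE x in \<nu>. x \<in> F"
    using \<nu>(3) F_sets by (simp add: \<nu>.AE_in_set_eq_1 \<nu>.emeasure_eq_measure)
  have sphere: "sphere 0 1 \<in> sets \<nu>"
    using \<nu>(2) by simp
  have AE_sphere: "AE x in \<nu>. x \<in> sphere 0 1"
    using AE_F by (rule eventually_mono) (use F(2) in auto)
  \<comment> \<open>The weak limit is a measure on the whole space, whereas
    \<open>prob_measures_on\<close> asks for one on the sphere.\<close>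
  define \<mu> where "\<mu> = restrict_space \<nu> (sphere 0 1)"
  have \<mu>: "\<mu> \<in> prob_measures_on F"
  proof -
    have "emeasure \<nu> (sphere 0 1) = 1"
      using sphere AE_sphere by (rule \<nu>.emeasure_eq_1_AE)
    then have "prob_space \<mu>"
      unfolding \<mu>_def using sphere by (intro prob_space_restrict_space)
    moreover have "sets \<mu> = sets (restrict_space borel (sphere 0 1))"
      unfolding \<mu>_def using \<nu>(2) by (rule sets_restrict_space_cong)
    moreover have "emeasure \<mu> (sphere 0 1 - F) = emeasure \<nu> (sphere 0 1 - F)"
      unfolding \<mu>_def using sphere by (intro emeasure_restrict_space) auto
    moreover have "emeasure \<nu> (sphere 0 1 - F) = 0"
    proof (subst AE_iff_measurable[symmetric])
      show "AE x in \<nu>. \<not> x \<in> sphere 0 1 - F"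
        using AE_F by (rule eventually_mono) auto
    qed (use F_sets sphere \<nu>(2) sets_eq_imp_space_eq[OF \<nu>(2)] in auto)
    ultimately show ?thesis
      by (simp add: prob_measures_on_def)
  qed
  interpret prob_space \<mu> by (rule prob_measures_onD(1)[OF \<mu>])
  have \<mu>_int: "(\<integral>x. h x \<partial>\<mu>) = (\<integral>x. h x \<partial>\<nu>)" if "h \<in> borel_measurable borel"
    for h :: "complex ^ 'n \<Rightarrow> real"
  proof -
    have [measurable]: "h \<in> borel_measurable \<nu>"
      using that measurable_cong_sets[OF \<nu>(2) refl] by blast
    have "(\<integral>x. indicator (sphere 0 1) x *\<^sub>R h x \<partial>\<nu>) = (\<integral>x. h x \<partial>\<nu>)"
    proof (rule integral_cong_AE)
      show "AE x in \<nu>. indicator (sphere 0 1) x *\<^sub>R h x = h x"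
        using AE_sphere by (rule eventually_mono) simp
    qed (use sphere in auto)
    then show ?thesis
      unfolding \<mu>_def using sphere by (subst integral_restrict_space) auto
  qed
  have "Re (\<integral>z. (\<integral>w. K (r *\<^sub>R z) (r *\<^sub>R w) \<partial>\<mu>) \<partial>\<mu>) \<le> b" if r: "0 \<le> r" "r < 1" for r
  proof -
    define u where "u z = (\<integral>w. K (r *\<^sub>R z) (r *\<^sub>R w) \<partial>\<mu>)" for z
    define E where "E = Re (\<integral>z. u z \<partial>\<mu>)"
    \<comment> \<open>Weak convergence is tested on bounded continuous functions on the whole space;
      projecting to the closed ball extends \<open>Re (u z)\<close> to such a function.\<close>
    define v where "v z = Re (u (closest_point (cball 0 1) z))" for z
    have u_cont: "continuous_on (cball 0 1) u"
      unfolding u_def using \<mu> r by (rule continuous_on_potential)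
    obtain B where B: "\<And>z. z \<in> cball 0 1 \<Longrightarrow> cmod (u z) \<le> B"
      using compact_imp_bounded[OF compact_continuous_image[OF u_cont compact_cball]]
      unfolding bounded_iff by (auto simp del: mem_cball mem_cball_0)
    have cp: "closest_point (cball 0 1) z \<in> cball (0 :: complex ^ 'n) 1" for z
      by (rule closest_point_in_set) auto
    have v_eq: "v z = Re (u z)" if "z \<in> cball 0 1" for z
      using closest_point_self[OF that] by (simp add: v_def)
    have v_cont: "continuous_on UNIV v"
      unfolding v_def using cp
      by (intro continuous_intros continuous_on_compose2[OF u_cont] continuous_on_closest_point)
         (auto simp del: mem_cball mem_cball_0)
    have "\<bar>v z\<bar> \<le> B" for z
      unfolding v_def using abs_Re_le_cmod B[OF cp] by (rule order_trans)
    then have v_bounded: "bounded (range v)"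
      by (intro boundedI[of _ B]) auto
    have u_int: "integrable \<mu> u"
      using B prob_measures_onD(3)[OF \<mu>]
      by (intro integrable_const_bound[where B = B] borel_measurable_continuous_on_sphere[OF \<mu>] u_cont)
         auto
    have "E = (\<integral>z. Re (u z) \<partial>\<mu>)"
      unfolding E_def using u_int by simp
    also have "\<dots> = (\<integral>z. v z \<partial>\<mu>)"
      using prob_measures_onD(3)[OF \<mu>] by (intro Bochner_Integration.integral_cong) (auto simp: v_eq)
    also have "\<dots> = (\<integral>z. v z \<partial>\<nu>)"
      using v_cont by (intro \<mu>_int borel_measurable_continuous_onI)
    finally have "(\<lambda>n. measure_pmf.expectation (p (\<sigma> n)) v) \<longlonglongrightarrow> E"
      using lim[OF v_cont v_bounded] by simp
    then have lim1: "(\<lambda>n. (measure_pmf.expectation (p (\<sigma> n)) v)\<^sup>2) \<longlonglongrightarrow> E\<^sup>2"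
      by (intro tendsto_intros)
    \<comment> \<open>Split by the sign of \<open>E\<close>, because the final inequality
      \<open>E^2 <= b E\<close> is divided by \<open>E\<close>.\<close>
    show ?thesis
    proof (cases "E \<le> 0")
      case True
      then show ?thesis
        using \<open>b \<ge> 0\<close> by (simp add: E_def u_def)
    next
      case False
      have "(\<lambda>n. 1 / real (Suc (\<sigma> n))) \<longlonglongrightarrow> 0"
        using LIMSEQ_subseq_LIMSEQ[OF LIMSEQ_Suc[OF lim_1_over_n] \<sigma>] by (simp add: o_def)
      then have lim2: "(\<lambda>n. (b + 1 / real (Suc (\<sigma> n))) * E) \<longlonglongrightarrow> (b + 0) * E"
        by (intro tendsto_intros)
      \<comment> \<open>The radius \<open>r\<close> is fixed while \<open>s (\<sigma> n)\<close>
        tends to 1, so eventually the energies at radius \<open>r\<close> are at most those at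
        \<open>s (\<sigma> n)\<close>, which are controlled.\<close>
      have "\<forall>\<^sub>F n in sequentially. r < (s \<circ> \<sigma>) n"
        using LIMSEQ_subseq_LIMSEQ[OF s_lim \<sigma>] r by (intro order_tendstoD)
      then have "\<forall>\<^sub>F n in sequentially.
          (measure_pmf.expectation (p (\<sigma> n)) v)\<^sup>2 \<le> (b + 1 / real (Suc (\<sigma> n))) * E"
      proof eventually_elim
        case (elim n)
        have sub: "set_pmf (p (\<sigma> n)) \<subseteq> cball 0 1"
          using p[of "\<sigma> n"] F(2) by auto
        have "measure_pmf.expectation (p (\<sigma> n)) v =
            (\<Sum>x\<in>set_pmf (p (\<sigma> n)). v x * pmf (p (\<sigma> n)) x)"
          by (rule integral_measure_pmf_real) (auto simp: fin)
        also have "\<dots> = (\<Sum>x\<in>set_pmf (p (\<sigma> n)). pmf (p (\<sigma> n)) x * Re (u x))"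
          using sub by (intro sum.cong refl) (auto simp: v_eq)
        finally have "(measure_pmf.expectation (p (\<sigma> n)) v)\<^sup>2 \<le> discrete_energy r (p (\<sigma> n)) * E"
          using discrete_potential_le[OF \<mu> r fin sub] by (simp add: u_def E_def)
        also have "\<dots> \<le> (b + 1 / real (Suc (\<sigma> n))) * E"
        proof (rule mult_right_mono)
          have "discrete_energy r (p (\<sigma> n)) \<le> discrete_energy (s (\<sigma> n)) (p (\<sigma> n))"
            using elim r s sub fin by (intro discrete_energy_mono) auto
          then show "discrete_energy r (p (\<sigma> n)) \<le> b + 1 / real (Suc (\<sigma> n))"
            using p_less[of "\<sigma> n"] by linarith
        qed (use False in auto)
        finally show ?case .
      qed
      then have "E\<^sup>2 \<le> (b + 0) * E"
        by (rule tendsto_le[OF _ lim2 lim1, rotated]) simp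
      then show ?thesis
        using False by (simp add: power2_eq_square E_def u_def)
    qed
  qed
  then have "energy K \<mu> \<le> ennreal b"
    unfolding energy_def by (intro SUP_least ennreal_leI) auto
  then show thesis
    using that \<mu> by blast
qed

end

section \<open>The two inequalities combined\<close>

theorem theorem7p1:
  fixes H :: "(complex ^ 'n \<Rightarrow> complex) set"
    and ip :: "(complex ^ 'n \<Rightarrow> complex) \<Rightarrow> (complex ^ 'n \<Rightarrow> complex) \<Rightarrow> complex"
    and K :: "complex ^ 'n \<Rightarrow> complex ^ 'n \<Rightarrow> complex"
    and F :: "(complex ^ 'n) set"
  assumes "unitarily_invariant_pluriharmonic_space H ip K"
    and "\<And>z w. z \<in> ball 0 1 \<Longrightarrow> w \<in> ball 0 1 \<Longrightarrow> Re (K z w) \<ge> 0"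
    and "compact F"
    and "F \<subseteq> sphere 0 1"
  shows "capacity K F =
    (INF f\<in>{f \<in> H. \<exists>g. continuous_extension f g \<and> (\<forall>z\<in>F. Re (g z) \<ge> 1)}.
       ennreal ((ip_norm ip f)\<^sup>2))"
proof -
  interpret unitarily_invariant_pluriharmonic_space H ip K by fact
  define A where "A = {f \<in> H. \<exists>g. continuous_extension f g \<and> (\<forall>z\<in>F. Re (g z) \<ge> 1)}"
  define J where "J = (INF f\<in>A. ennreal ((ip_norm ip f)\<^sup>2))"
  have "capacity K F \<le> J"
    unfolding capacity_def J_def
    using dual_le[OF compact_imp_closed[OF \<open>compact F\<close>]]
    by (intro SUP_least INF_greatest) (auto simp: A_def)
  moreover have "J \<le> capacity K F"
  proof (cases "F = {}")
    case True
    \<comment> \<open>With \<open>F\<close> empty the constraint is void, and \<open>f = 0\<close>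
      shows \<open>J = 0\<close>.\<close>
    have "continuous_extension (\<lambda>_. 0) (\<lambda>_. 0)"
      by (simp add: continuous_extension_def)
    then have "(\<lambda>_. 0) \<in> A"
      using True zero_mem by (auto simp: A_def)
    then have "J \<le> ennreal ((ip_norm ip (\<lambda>_. 0))\<^sup>2)"
      unfolding J_def by (rule INF_lower)
    then show ?thesis
      using ip_zero_left[OF zero_mem] by (simp add: ip_norm_def)
  next
    case False
    then have "F \<noteq> {}" .
    \<comment> \<open>\<open>J\<close> may be infinite, so every smaller \<open>x\<close> is treated
      instead; a nonzero one is a positive real \<open>I\<close> that bounds all admissible squared
      norms from below.\<close>
    show ?thesis
    proof (rule dense_le)
      fix x
      assume "x < J"
      show "x \<le> capacity K F"
      proof (cases "x = 0")
        case False
        have "x < top"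
          using \<open>x < J\<close> top_greatest by (rule less_le_trans)
        with False obtain I where "I > 0" and x: "x = ennreal I"
          by (cases x rule: ennreal_cases) (auto simp: le_less)
        have I_le: "I \<le> (ip_norm ip f)\<^sup>2"
          if "f \<in> H" "\<exists>g. continuous_extension f g \<and> (\<forall>z\<in>F. Re (g z) \<ge> 1)" for f
        proof -
          have "J \<le> ennreal ((ip_norm ip f)\<^sup>2)"
            unfolding J_def using that by (intro INF_lower) (auto simp: A_def)
          with \<open>x < J\<close> have "ennreal I \<le> ennreal ((ip_norm ip f)\<^sup>2)"
            unfolding x by order
          then show ?thesis
            by simp
        qed
        have "F \<subseteq> cball 0 1"
          using \<open>F \<subseteq> sphere 0 1\<close> by auto
        then have "\<exists>p. finite (set_pmf p) \<and> set_pmf p \<subseteq> F \<and> discrete_energy r p < 1 / I + \<epsilon>"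
          if "0 \<le> r" "r < 1" "\<epsilon> > 0" for r \<epsilon>
          using exists_discrete_energy_less[OF \<open>F \<noteq> {}\<close> _ that(1,2) \<open>I > 0\<close> that(3) I_le] by blast
        then obtain \<mu> where \<mu>: "\<mu> \<in> prob_measures_on F" "energy K \<mu> \<le> ennreal (1 / I)"
          using exists_measure_energy_le[OF assms(3,4), of "1 / I"] \<open>I > 0\<close> by force
        \<comment> \<open>For \<open>e = 0\<close> the right side is infinite, and infinite energy
          contradicts the bound by \<open>1 / I\<close>.\<close>
        have "ennreal I \<le> 1 / energy K \<mu>"
        proof (cases "energy K \<mu>")
          case (real e)
          then have "e \<le> 1 / I"
            using \<mu>(2) \<open>I > 0\<close> by (simp add: ennreal_le_iff)
          show ?thesis
          proof (cases "e = 0")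
            case False
            then have "I \<le> 1 / e"
              using real \<open>e \<le> 1 / I\<close> \<open>I > 0\<close> by (simp add: field_simps)
            then have "ennreal I \<le> ennreal (1 / e)"
              by (rule ennreal_leI)
            then show ?thesis
              using False real by (simp add: divide_ennreal flip: ennreal_1)
          qed (use real in simp)
        qed (use \<mu>(2) in \<open>simp add: top_unique\<close>)
        also have "\<dots> \<le> capacity K F"
          unfolding capacity_def using \<mu>(1) by (rule SUP_upper)
        finally show ?thesis
          unfolding x .
      qed simp
    qed
  qed
  ultimately show ?thesis
    by (simp add: J_def A_def)
qed

end
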